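(* Let $K\ge 1$, let $\Omega\subset\mathbb{C}$ be a Jordan domain with $C^{1,1}$ boundary, and let $a\in\Omega$. Then there exists a constant $c=c(K,\Omega,a)\ge 1$, depending only on $K$, $\Omega$ and $a$, such that every harmonic $K$-quasiconformal mapping $f$ of the unit disk $\mathbb{U}=\{z\in\mathbb{C}:|z|<1\}$ onto $\Omega$ with $f(0)=a$ is co-Lipschitz with constant $c$, i.e. $$\frac1c\,|z_1-z_2|\le |f(z_1)-f(z_2)|\qquad\text{for all } z_1,z_2\in\mathbb{U}.$$
   Context: A Jordan domain is the bounded domain enclosed by a Jordan curve. A complex-valued function $f=u+iv$ is harmonic if $u$ and $v$ are real-valued harmonic functions; it need not be holomorphic. A real function on a domain $D$ is ACL if for every closed rectangle $R\subset D$ with sides parallel to the axes it is absolutely continuous on almost every horizontal and almost every vertical line in $R$ (for complex-valued functions, apply this to the real and imaginary parts). A homeomorphism $f:D\to G$ between domains of $\mathbb{C}$ is $K$-quasiconformal ($K\ge1$) if $f$ is ACL and $|\nabla f(z)|\le K\,l(\nabla f(z))$ for a.e. $z\in D$, where $|\nabla f|=|f_z|+|f_{\bar z}|$ and $l(\nabla f)=|f_z|-|f_{\bar z}|$. A rectifiable Jordan curve $\gamma$ of length $l$ is of class $C^{k,\alpha}$ ($k\in\mathbb{N}$, $0<\alpha\le1$) if its arc-length parametrization $g$ (regarded as an $l$-periodic function on $\mathbb{R}$) is $C^k$ and $\sup_{t\ne s}|g^{(k)}(t)-g^{(k)}(s)|/|t-s|^\alpha<\infty$. *)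

theory Defs
  imports "HOL-Analysis.Analysis"
begin

section \<open>Partial derivatives and harmonic functions\<close>

definition partial_x :: "(complex \<Rightarrow> 'a::real_normed_vector) \<Rightarrow> complex \<Rightarrow> 'a" where
  "partial_x f z = vector_derivative (\<lambda>t::real. f (z + of_real t)) (at 0)"

definition partial_y :: "(complex \<Rightarrow> 'a::real_normed_vector) \<Rightarrow> complex \<Rightarrow> 'a" where
  "partial_y f z = vector_derivative (\<lambda>t::real. f (z + \<i> * of_real t)) (at 0)"

text \<open>On an open set \<open>D\<close>, all conditions but the last say that \<open>u\<close> is of class \<open>C\<^sup>2\<close>;
  differentiability is that of functions of two real variables.\<close>

definition real_harmonic_on :: "complex set \<Rightarrow> (complex \<Rightarrow> real) \<Rightarrow> bool" where
  "real_harmonic_on D u \<longleftrightarrow>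
     u differentiable_on D \<and>
     partial_x u differentiable_on D \<and>
     partial_y u differentiable_on D \<and>
     continuous_on D (partial_x (partial_x u)) \<and> continuous_on D (partial_x (partial_y u)) \<and>
     continuous_on D (partial_y (partial_x u)) \<and> continuous_on D (partial_y (partial_y u)) \<and>
     (\<forall>z\<in>D. partial_x (partial_x u) z + partial_y (partial_y u) z = 0)"

definition harmonic_on :: "complex set \<Rightarrow> (complex \<Rightarrow> complex) \<Rightarrow> bool" where
  "harmonic_on D f \<longleftrightarrow>
     real_harmonic_on D (\<lambda>z. Re (f z)) \<and> real_harmonic_on D (\<lambda>z. Im (f z))"

section \<open>Quasiconformal mappings\<close>

definition plane_domain :: "complex set \<Rightarrow> bool" where
  "plane_domain D \<longleftrightarrow> open D \<and> connected D \<and> D \<noteq> {}"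

text \<open>Absolute continuity of a function on a compact interval in the usual sense of real
  analysis; this is unrelated to the library's \<^const>\<open>absolutely_continuous\<close>, which
  concerns measures.\<close>

definition abs_continuous_on_Icc :: "real \<Rightarrow> real \<Rightarrow> (real \<Rightarrow> real) \<Rightarrow> bool" where
  "abs_continuous_on_Icc a b \<phi> \<longleftrightarrow>
     (\<forall>\<epsilon>>0. \<exists>\<delta>>0. \<forall>(n::nat) (s::nat \<Rightarrow> real) (t::nat \<Rightarrow> real).
        (\<forall>i<n. a \<le> s i \<and> s i \<le> t i \<and> t i \<le> b) \<and>
        (\<forall>i<n. \<forall>j<n. i \<noteq> j \<longrightarrow> {s i<..<t i} \<inter> {s j<..<t j} = {}) \<and>
        (\<Sum>i<n. t i - s i) < \<delta>
        \<longrightarrow> (\<Sum>i<n. \<bar>\<phi> (t i) - \<phi> (s i)\<bar>) < \<epsilon>)"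

text \<open>For complex \<open>p\<close>, \<open>q\<close>, the set \<open>cbox p q\<close> is the closed rectangle with sides parallel
  to the axes, lower left corner \<open>p\<close> and upper right corner \<open>q\<close>.\<close>

definition real_ACL_on :: "complex set \<Rightarrow> (complex \<Rightarrow> real) \<Rightarrow> bool" where
  "real_ACL_on D u \<longleftrightarrow>
     (\<forall>p q. cbox p q \<subseteq> D \<longrightarrow>
        (AE y in lborel. y \<in> {Im p..Im q} \<longrightarrow>
            abs_continuous_on_Icc (Re p) (Re q) (\<lambda>x. u (Complex x y))) \<and>
        (AE x in lborel. x \<in> {Re p..Re q} \<longrightarrow>
            abs_continuous_on_Icc (Im p) (Im q) (\<lambda>y. u (Complex x y))))"

definition ACL_on :: "complex set \<Rightarrow> (complex \<Rightarrow> complex) \<Rightarrow> bool" where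
  "ACL_on D f \<longleftrightarrow> real_ACL_on D (\<lambda>z. Re (f z)) \<and> real_ACL_on D (\<lambda>z. Im (f z))"

definition deriv_z :: "(complex \<Rightarrow> complex) \<Rightarrow> complex \<Rightarrow> complex" where
  "deriv_z f z = (partial_x f z - \<i> * partial_y f z) / 2"

definition deriv_zbar :: "(complex \<Rightarrow> complex) \<Rightarrow> complex \<Rightarrow> complex" where
  "deriv_zbar f z = (partial_x f z + \<i> * partial_y f z) / 2"

definition grad_norm :: "(complex \<Rightarrow> complex) \<Rightarrow> complex \<Rightarrow> real" where
  "grad_norm f z = cmod (deriv_z f z) + cmod (deriv_zbar f z)"

definition grad_conorm :: "(complex \<Rightarrow> complex) \<Rightarrow> complex \<Rightarrow> real" where
  "grad_conorm f z = cmod (deriv_z f z) - cmod (deriv_zbar f z)"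

text \<open>The ACL property guarantees that the partial derivatives exist almost everywhere
  in \<open>D\<close>, so that the default value of \<^const>\<open>vector_derivative\<close> at other points is
  irrelevant.\<close>

definition quasiconformal ::
    "real \<Rightarrow> complex set \<Rightarrow> complex set \<Rightarrow> (complex \<Rightarrow> complex) \<Rightarrow> bool" where
  "quasiconformal K D G f \<longleftrightarrow>
     K \<ge> 1 \<and> plane_domain D \<and> plane_domain G \<and>
     (\<exists>g. homeomorphism D G f g) \<and>
     ACL_on D f \<and>
     (AE z in lborel. z \<in> D \<longrightarrow> grad_norm f z \<le> K * grad_conorm f z)"

section \<open>Jordan domains and smoothness of their boundary\<close>

definition Jordan_curve :: "complex set \<Rightarrow> bool" where
  "Jordan_curve \<Gamma> \<longleftrightarrow>
     (\<exists>\<gamma>. simple_path \<gamma> \<and> pathfinish \<gamma> = pathstart \<gamma> \<and> path_image \<gamma> = \<Gamma>)"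

definition Jordan_domain :: "complex set \<Rightarrow> bool" where
  "Jordan_domain \<Omega> \<longleftrightarrow> (\<exists>\<Gamma>. Jordan_curve \<Gamma> \<and> \<Omega> = inside \<Gamma>)"

text \<open>Length of a parametrized curve over \<open>[a, b]\<close>: the supremum of the lengths of inscribed
  polygonal lines.\<close>

definition curve_length :: "(real \<Rightarrow> complex) \<Rightarrow> real \<Rightarrow> real \<Rightarrow> ennreal" where
  "curve_length g a b =
     (SUP ts \<in> {ts. sorted ts \<and> set ts \<subseteq> {a..b}}.
        ennreal (\<Sum>i<length ts - 1. cmod (g (ts ! Suc i) - g (ts ! i))))"

text \<open>\<open>g\<close> is an arc-length parametrization of the Jordan curve \<open>\<Gamma>\<close> of length \<open>l\<close>, extended
  \<open>l\<close>-periodically. Such a \<open>g\<close> exists exactly if \<open>\<Gamma>\<close> is rectifiable of length \<open>l\<close>, and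
  it is then unique up to the choice of starting point and orientation.\<close>

definition arc_length_parametrization ::
    "complex set \<Rightarrow> real \<Rightarrow> (real \<Rightarrow> complex) \<Rightarrow> bool" where
  "arc_length_parametrization \<Gamma> l g \<longleftrightarrow>
     l > 0 \<and> (\<forall>t. g (t + l) = g t) \<and> inj_on g {0..<l} \<and> g ` {0..<l} = \<Gamma> \<and>
     (\<forall>s t. s \<le> t \<longrightarrow> curve_length g s t = ennreal (t - s))"

definition higher_vderiv :: "nat \<Rightarrow> (real \<Rightarrow> complex) \<Rightarrow> real \<Rightarrow> complex" where
  "higher_vderiv k g = ((\<lambda>h t. vector_derivative h (at t)) ^^ k) g"

definition C_k :: "nat \<Rightarrow> (real \<Rightarrow> complex) \<Rightarrow> bool" where
  "C_k k g \<longleftrightarrow>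
     (\<forall>i<k. higher_vderiv i g differentiable_on UNIV) \<and> continuous_on UNIV (higher_vderiv k g)"

text \<open>The class \<open>C\<^sup>k\<^sup>,\<^sup>\<alpha>\<close>; by the uniqueness just mentioned, the choice of \<open>g\<close> does not
  matter.\<close>

definition Jordan_curve_of_class :: "nat \<Rightarrow> real \<Rightarrow> complex set \<Rightarrow> bool" where
  "Jordan_curve_of_class k \<alpha> \<Gamma> \<longleftrightarrow>
     0 < \<alpha> \<and> \<alpha> \<le> 1 \<and> Jordan_curve \<Gamma> \<and>
     (\<exists>l g. arc_length_parametrization \<Gamma> l g \<and> C_k k g \<and>
        bdd_above {cmod (higher_vderiv k g t - higher_vderiv k g s) / \<bar>t - s\<bar> powr \<alpha> | s t. s \<noteq> t})"

end

theory Submission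
  imports Defs "HOL-Complex_Analysis.Complex_Analysis"
begin

text \<open>Write \<open>f = g + cnj h\<close> with holomorphic \<open>g\<close> and \<open>h\<close> on the unit disk. Quasiconformality says
\<open>\<bar>g'\<bar> + \<bar>h'\<bar> \<le> K (\<bar>g'\<bar> - \<bar>h'\<bar>)\<close>, first almost everywhere and then, by continuity, everywhere. Hence
the inverse \<open>\<psi>\<close> of \<open>f\<close> has differential of norm at most \<open>K / \<bar>g'\<bar>\<close>, and the theorem amounts to two
things: a lower bound of \<open>\<bar>g'\<bar>\<close> that depends only on \<open>K\<close>, \<open>\<Omega>\<close> and \<open>a\<close>, and the passage from this
infinitesimal estimate to points of \<open>\<Omega>\<close> whose segment leaves \<open>\<Omega>\<close>.

The lower bound combines two estimates at a point \<open>z\<close> of the disk.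

\<^item> \<open>\<bar>g'(z)\<bar> (1 - \<bar>z\<bar>\<^sup>2) \<ge> d / 2\<close> whenever \<open>\<Omega>\<close> contains the ball of radius \<open>d\<close> about \<open>f z\<close>
  (\<open>deriv_g_ge_dist\<close>). If the differential of \<open>f\<close> maps \<open>v\<close> to \<open>\<delta>\<close>, then
  \<open>\<bar>\<delta> - g' v\<bar> = \<bar>h' v\<bar> \<le> \<bar>g' v\<bar>\<close>, which forces \<open>Re (cnj \<delta> * g' v) \<ge> \<bar>\<delta>\<bar>\<^sup>2 / 2\<close>. Integrated along
  segments in \<open>\<Omega>\<close>, this makes \<open>g \<circ> \<psi>\<close> strongly monotone on balls in \<open>\<Omega>\<close>: it is injective there and
  shrinks distances by at most a factor two. It follows that \<open>g'\<close> has no zeros (a theorem of Lewy),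
  and that \<open>g\<close> maps a part of the disk univalently onto a region containing a ball of radius
  \<open>d / 2\<close>; the Schwarz lemma for the inverse of \<open>g\<close> on this ball gives the estimate.

\<^item> \<open>dist (f z) (\<partial>\<Omega>) \<ge> const * (1 - \<bar>z\<bar>)\<close> (\<open>dist_exterior_ball_ge\<close>, in the proof of
  \<open>deriv_g_lower_bound\<close>). If a ball of radius \<open>\<rho>\<close> and center \<open>q\<close> lies outside \<open>\<Omega>\<close>, then
  \<open>exp (- l \<bar>f - q\<bar>\<^sup>2)\<close> is subharmonic for \<open>l = K\<^sup>2 / \<rho>\<^sup>2\<close>, because dilatation bounded by \<open>K\<close>
  lets the second radial derivative outweigh the tangential ones. The comparison with
  \<open>exp (- m \<bar>z\<bar>\<^sup>2)\<close> on an annulus, as in Hopf's boundary point lemma, bounds \<open>\<bar>f z - q\<bar> - \<rho>\<close>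
  from below by a multiple of \<open>1 - \<bar>z\<bar>\<close>. The exterior ball is taken tangent to the boundary at the
  point nearest to \<open>f z\<close>. The only normalization that enters is \<open>f 0 = a\<close>: bounded harmonic
  functions are equicontinuous at \<open>0\<close>, so \<open>f\<close> stays away from the boundary near \<open>0\<close>.

The hypothesis \<open>C\<^sup>1\<^sup>,\<^sup>1\<close> enters through the existence, for some fixed radius, of an interior and an
exterior tangent ball at every boundary point (\<open>Jordan_domain_C11_two_sided_ball_condition\<close>). These
balls also make the normal a Lipschitz function of the boundary point, so that two points at small
distance \<open>s\<close> can be joined inside \<open>\<Omega>\<close> by a polygon of length at most \<open>26 s\<close>: move both along the
normals to depth \<open>9 s\<close>, where the segment between them stays inside
(\<open>two_sided_ball_condition_short_polygon\<close>). For points at larger distance the estimate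
is trivial since the disk has diameter two.\<close>

section \<open>Harmonic functions and holomorphic functions\<close>

lemma partial_x_eq:
  assumes "(u has_derivative D) (at z)"
  shows "partial_x u z = D 1"
proof -
  have "((\<lambda>t::real. u (z + of_real t)) has_derivative (\<lambda>t. D (of_real t))) (at 0)"
    by (rule has_derivative_compose[of "\<lambda>t. z + of_real t" "\<lambda>t. of_real t" _ _ u D])
      (use assms in \<open>auto intro!: derivative_eq_intros\<close>)
  moreover have "D (of_real t) = t *\<^sub>R D 1" for t
    using linear_cmul[OF has_derivative_linear[OF assms], of t 1] by (simp add: scaleR_conv_of_real)
  ultimately show ?thesis
    unfolding partial_x_def by (intro vector_derivative_at) (simp add: has_vector_derivative_def)
qed

lemma partial_y_eq:
  assumes "(u has_derivative D) (at z)"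
  shows "partial_y u z = D \<i>"
proof -
  have "((\<lambda>t::real. u (z + \<i> * of_real t)) has_derivative (\<lambda>t. D (\<i> * of_real t))) (at 0)"
    by (rule has_derivative_compose[of "\<lambda>t. z + \<i> * of_real t" "\<lambda>t. \<i> * of_real t" _ _ u D])
      (use assms in \<open>auto intro!: derivative_eq_intros\<close>)
  moreover have "D (\<i> * of_real t) = t *\<^sub>R D \<i>" for t
    using linear_cmul[OF has_derivative_linear[OF assms], of t \<i>]
    by (simp add: scaleR_conv_of_real mult.commute)
  ultimately show ?thesis
    unfolding partial_y_def by (intro vector_derivative_at) (simp add: has_vector_derivative_def)
qed

lemma has_derivative_partials:
  assumes "u differentiable (at z)"
  shows "(u has_derivative (\<lambda>v. Re v *\<^sub>R partial_x u z + Im v *\<^sub>R partial_y u z)) (at z)"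
proof -
  obtain D where D: "(u has_derivative D) (at z)"
    using assms by (auto simp: differentiable_def)
  have "D v = Re v *\<^sub>R D 1 + Im v *\<^sub>R D \<i>" for v
  proof -
    have "v = Re v *\<^sub>R 1 + Im v *\<^sub>R \<i>" by (simp add: complex_eq_iff)
    then have "D v = D (Re v *\<^sub>R 1 + Im v *\<^sub>R \<i>)" by simp
    also have "\<dots> = Re v *\<^sub>R D 1 + Im v *\<^sub>R D \<i>"
      using has_derivative_linear[OF D] by (simp only: linear_add linear_cmul)
    finally show ?thesis .
  qed
  then have "D = (\<lambda>v. Re v *\<^sub>R partial_x u z + Im v *\<^sub>R partial_y u z)"
    unfolding partial_x_eq[OF D] partial_y_eq[OF D] by (rule ext)
  with D show ?thesis by simp
qed

lemma partial_x_mvt: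
  fixes u :: "complex \<Rightarrow> real"
  assumes "t > 0" "\<And>s. 0 \<le> s \<Longrightarrow> s \<le> t \<Longrightarrow> u differentiable (at (z + of_real s))"
  obtains s where "0 < s" "s < t" "u (z + of_real t) - u z = t * partial_x u (z + of_real s)"
proof -
  have "((\<lambda>s. u (z + of_real s)) has_field_derivative partial_x u (z + of_real s)) (at s)"
    if "0 \<le> s" "s \<le> t" for s
  proof -
    have "((\<lambda>s. u (z + of_real s)) has_derivative
       (\<lambda>v. Re (of_real v) *\<^sub>R partial_x u (z + of_real s) + Im (of_real v) *\<^sub>R partial_y u (z + of_real s))) (at s)"
    proof -
      have L: "((\<lambda>s. z + of_real s) has_derivative of_real) (at s)"
        by (auto intro!: derivative_eq_intros)
      show ?thesis
        by (rule has_derivative_compose[OF L has_derivative_partials[OF assms(2)[OF that]]])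
    qed
    then show ?thesis by (simp add: has_field_derivative_def mult_commute_abs)
  qed
  from MVT2[OF assms(1) this] show ?thesis using that by auto
qed

lemma partial_y_mvt:
  fixes u :: "complex \<Rightarrow> real"
  assumes "t > 0" "\<And>s. 0 \<le> s \<Longrightarrow> s \<le> t \<Longrightarrow> u differentiable (at (z + \<i> * of_real s))"
  obtains s where "0 < s" "s < t" "u (z + \<i> * of_real t) - u z = t * partial_y u (z + \<i> * of_real s)"
proof -
  have "((\<lambda>s. u (z + \<i> * of_real s)) has_field_derivative partial_y u (z + \<i> * of_real s)) (at s)"
    if "0 \<le> s" "s \<le> t" for s
  proof -
    have "((\<lambda>s. u (z + \<i> * of_real s)) has_derivative
       (\<lambda>v. Re (\<i> * of_real v) *\<^sub>R partial_x u (z + \<i> * of_real s) + Im (\<i> * of_real v) *\<^sub>R partial_y u (z + \<i> * of_real s))) (at s)"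
    proof -
      have L: "((\<lambda>s. z + \<i> * of_real s) has_derivative (\<lambda>v. \<i> * of_real v)) (at s)"
        by (auto intro!: derivative_eq_intros)
      show ?thesis
        by (rule has_derivative_compose[OF L has_derivative_partials[OF assms(2)[OF that]]])
    qed
    then show ?thesis by (simp add: has_field_derivative_def mult_commute_abs)
  qed
  from MVT2[OF assms(1) this] show ?thesis using that by auto
qed

lemma differentiable_partial_shift:
  assumes "u differentiable (at (z + w))"
  shows "(\<lambda>z. u (z + w)) differentiable (at z)"
    "partial_x (\<lambda>z. u (z + w)) z = partial_x u (z + w)"
    "partial_y (\<lambda>z. u (z + w)) z = partial_y u (z + w)"
proof -
  obtain D where D: "(u has_derivative D) (at (z + w))"
    using assms by (auto simp: differentiable_def)
  have L: "((\<lambda>z. z + w) has_derivative (\<lambda>v. v)) (at z)" by (auto intro!: derivative_eq_intros)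
  have E: "((\<lambda>z. u (z + w)) has_derivative D) (at z)"
    by (rule has_derivative_compose[OF L D])
  show "(\<lambda>z. u (z + w)) differentiable (at z)"
    using E by (auto simp: differentiable_def)
  show "partial_x (\<lambda>z. u (z + w)) z = partial_x u (z + w)"
    by (simp only: partial_x_eq[OF D] partial_x_eq[OF E])
  show "partial_y (\<lambda>z. u (z + w)) z = partial_y u (z + w)"
    by (simp only: partial_y_eq[OF D] partial_y_eq[OF E])
qed

lemma partial_diff:
  assumes "u differentiable (at z)" "v differentiable (at z)"
  shows "(\<lambda>z. u z - v z) differentiable (at z)"
    "partial_x (\<lambda>z. u z - v z) z = partial_x u z - partial_x v z"
    "partial_y (\<lambda>z. u z - v z) z = partial_y u z - partial_y v z"
proof -
  obtain D E where D: "(u has_derivative D) (at z)" and E: "(v has_derivative E) (at z)"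
    using assms by (auto simp: differentiable_def)
  note DE = has_derivative_diff[OF D E]
  show "(\<lambda>z. u z - v z) differentiable (at z)"
    using DE by (auto simp: differentiable_def)
  show "partial_x (\<lambda>z. u z - v z) z = partial_x u z - partial_x v z"
    by (simp only: partial_x_eq[OF D] partial_x_eq[OF E] partial_x_eq[OF DE])
  show "partial_y (\<lambda>z. u z - v z) z = partial_y u z - partial_y v z"
    by (simp only: partial_y_eq[OF D] partial_y_eq[OF E] partial_y_eq[OF DE])
qed

text \<open>Needed because harmonicity as defined gives both mixed derivatives without relating them, and the
Cauchy--Riemann equations for the complex gradient \<open>u\<^sub>x - \<i> u\<^sub>y\<close> require their equality. The two mean
value theorems express the same second difference by one mixed derivative or by the other.\<close>

lemma mixed_partials_commute:
  fixes u :: "complex \<Rightarrow> real"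
  assumes D: "open D" "z \<in> D"
    and du: "u differentiable_on D" "partial_x u differentiable_on D" "partial_y u differentiable_on D"
    and ct: "continuous_on D (partial_x (partial_y u))" "continuous_on D (partial_y (partial_x u))"
  shows "partial_x (partial_y u) z = partial_y (partial_x u) z"
proof (rule ccontr)
  let ?xy = "partial_x (partial_y u)" and ?yx = "partial_y (partial_x u)"
  assume "?xy z \<noteq> ?yx z"
  define e where "e = \<bar>?xy z - ?yx z\<bar> / 2"
  have e: "e > 0" using \<open>?xy z \<noteq> ?yx z\<close> by (simp add: e_def)
  have ev: "\<forall>\<^sub>F w in nhds z. w \<in> D \<and> \<bar>?xy w - ?xy z\<bar> < e \<and> \<bar>?yx w - ?yx z\<bar> < e"
  proof (intro eventually_conj)
    show "\<forall>\<^sub>F w in nhds z. w \<in> D" using D by (rule eventually_nhds_in_open)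
    have "isCont ?xy z" "isCont ?yx z"
      using ct D continuous_on_eq_continuous_at by blast+
    then show "\<forall>\<^sub>F w in nhds z. \<bar>?xy w - ?xy z\<bar> < e" "\<forall>\<^sub>F w in nhds z. \<bar>?yx w - ?yx z\<bar> < e"
      using e by (auto simp: continuous_at tendsto_at_iff_tendsto_nhds dist_real_def dest!: tendstoD[where e=e])
  qed
  then obtain d where d: "d > 0"
    and dw: "\<And>w. dist w z < d \<Longrightarrow> w \<in> D \<and> \<bar>?xy w - ?xy z\<bar> < e \<and> \<bar>?yx w - ?yx z\<bar> < e"
    by (auto simp: eventually_nhds_metric)
  have near: "dist (z + of_real s + \<i> * of_real r) z < d" "dist (z + \<i> * of_real r + of_real s) z < d"
    if "0 \<le> s" "s \<le> d/3" "0 \<le> r" "r \<le> d/3" for s r :: real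
  proof -
    have "cmod (of_real s + \<i> * of_real r) \<le> s + r"
      by (rule norm_triangle_le) (use that in \<open>auto simp: norm_mult\<close>)
    also have "\<dots> < d" using that d by simp
    finally show "dist (z + of_real s + \<i> * of_real r) z < d" "dist (z + \<i> * of_real r + of_real s) z < d"
      by (simp_all add: dist_norm algebra_simps)
  qed
  define t where "t = d/3"
  have t: "t > 0" "t \<le> d/3" using d by (auto simp: t_def)
  have dif: "u differentiable (at w)" "partial_x u differentiable (at w)" "partial_y u differentiable (at w)"
    if "dist w z < d" for w
    using dw[OF that] du differentiable_on_eq_differentiable_at[OF D(1)] by blast+
  \<comment> \<open>The second difference of \<open>u\<close> over a square of side \<open>t\<close>, evaluated in the two possible orders.\<close>
  define S where "S = u (z + of_real t + \<i> * of_real t) - u (z + of_real t) - u (z + \<i> * of_real t) + u z"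
  obtain s r where s: "0 < s" "s < t" "0 < r" "r < t"
    and S1: "S = t * (t * ?yx (z + of_real s + \<i> * of_real r))"
  proof -
    let ?v = "\<lambda>w. u (w + \<i> * of_real t) - u w"
    have vd: "?v differentiable (at (z + of_real s))" 
         "partial_x ?v (z + of_real s) = partial_x u (z + of_real s + \<i> * of_real t) - partial_x u (z + of_real s)"
      if "0 \<le> s" "s \<le> t" for s
    proof -
      have 1: "u differentiable (at (z + of_real s + \<i> * of_real t))" "u differentiable (at (z + of_real s))"
        using near[of s t] near[of s 0] that t by (auto intro!: dif)
      note sh = differentiable_partial_shift[OF 1(1)]
      show "?v differentiable (at (z + of_real s))" 
         "partial_x ?v (z + of_real s) = partial_x u (z + of_real s + \<i> * of_real t) - partial_x u (z + of_real s)"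
        using partial_diff[OF sh(1) 1(2)] sh by auto
    qed
    obtain s where s: "0 < s" "s < t" "?v (z + of_real t) - ?v z = t * partial_x ?v (z + of_real s)"
      by (rule partial_x_mvt[OF t(1), of ?v z]) (use vd in auto)
    obtain r where r: "0 < r" "r < t" 
      "partial_x u (z + of_real s + \<i> * of_real t) - partial_x u (z + of_real s) = t * ?yx (z + of_real s + \<i> * of_real r)"
    proof (rule partial_y_mvt[OF t(1), of "partial_x u" "z + of_real s"])
      show "partial_x u differentiable at (z + of_real s + \<i> * of_real r)" if "0 \<le> r" "r \<le> t" for r
        using that s t by (intro dif(2) near(1)) auto
    qed
    show thesis using that[of s r] s r vd[of s] by (simp add: S_def)
  qed
  obtain s' r' where s': "0 < s'" "s' < t" "0 < r'" "r' < t"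
    and S2: "S = t * (t * ?xy (z + \<i> * of_real r' + of_real s'))"
  proof -
    let ?v = "\<lambda>w. u (w + of_real t) - u w"
    have vd: "?v differentiable (at (z + \<i> * of_real s))" 
         "partial_y ?v (z + \<i> * of_real s) = partial_y u (z + \<i> * of_real s + of_real t) - partial_y u (z + \<i> * of_real s)"
      if "0 \<le> s" "s \<le> t" for s
    proof -
      have 1: "u differentiable (at (z + \<i> * of_real s + of_real t))" "u differentiable (at (z + \<i> * of_real s))"
        using near[of t s] near[of 0 s] that t by (auto intro!: dif)
      note sh = differentiable_partial_shift[OF 1(1)]
      show "?v differentiable (at (z + \<i> * of_real s))" 
         "partial_y ?v (z + \<i> * of_real s) = partial_y u (z + \<i> * of_real s + of_real t) - partial_y u (z + \<i> * of_real s)"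
        using partial_diff[OF sh(1) 1(2)] sh by auto
    qed
    obtain s where s: "0 < s" "s < t" "?v (z + \<i> * of_real t) - ?v z = t * partial_y ?v (z + \<i> * of_real s)"
      by (rule partial_y_mvt[OF t(1), of ?v z]) (use vd in auto)
    obtain r where r: "0 < r" "r < t" 
      "partial_y u (z + \<i> * of_real s + of_real t) - partial_y u (z + \<i> * of_real s) = t * ?xy (z + \<i> * of_real s + of_real r)"
    proof (rule partial_x_mvt[OF t(1), of "partial_y u" "z + \<i> * of_real s"])
      show "partial_y u differentiable at (z + \<i> * of_real s + of_real r)" if "0 \<le> r" "r \<le> t" for r
        using that s t by (intro dif(3) near(2)) auto
    qed
    show thesis using that[of r s] s r vd[of s] by (simp add: S_def algebra_simps)
  qed
  have "?yx (z + of_real s + \<i> * of_real r) = ?xy (z + \<i> * of_real r' + of_real s')"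
    using S1 S2 t by simp
  moreover have "\<bar>?yx (z + of_real s + \<i> * of_real r) - ?yx z\<bar> < e" 
    "\<bar>?xy (z + \<i> * of_real r' + of_real s') - ?xy z\<bar> < e"
    using dw near s s' t by auto
  moreover have False if "\<bar>c - b\<bar> < \<bar>a - b\<bar> / 2" "\<bar>c - a\<bar> < \<bar>a - b\<bar> / 2" for a b c :: real
    using that by (auto simp: abs_if split: if_splits)
  ultimately show False unfolding e_def by metis
qed

text \<open>The complex gradient \<open>u\<^sub>x - \<i> u\<^sub>y\<close> is holomorphic, and on a convex set it has a primitive, whose real
part differs from \<open>u\<close> by a constant.\<close>

lemma real_harmonic_on_eq_Re_holomorphic:
  assumes "open D" "convex D" "real_harmonic_on D u"
  obtains P where "P holomorphic_on D" "\<And>z. z \<in> D \<Longrightarrow> u z = Re (P z)"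
proof (cases "D = {}")
  case False
  then obtain z0 where z0: "z0 \<in> D" by blast
  define \<phi> where "\<phi> = (\<lambda>z. complex_of_real (partial_x u z) - \<i> * complex_of_real (partial_y u z))"
  note h = assms(3)[unfolded real_harmonic_on_def]
  have "(\<phi> has_field_derivative Complex (partial_x (partial_x u) z) (- partial_y (partial_x u) z)) (at z)" 
    if z: "z \<in> D" for z
  proof -
    have "partial_x u differentiable (at z)" "partial_y u differentiable (at z)"
      using h z differentiable_on_eq_differentiable_at[OF assms(1)] by blast+
    note 1 = has_derivative_partials[OF this(1)] has_derivative_partials[OF this(2)]
    have 2: "partial_x (partial_y u) z = partial_y (partial_x u) z"
      using h by (intro mixed_partials_commute[OF assms(1) z]) auto
    have 3: "partial_y (partial_y u) z = - partial_x (partial_x u) z"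
      using h z by (auto simp: add_eq_0_iff)
    have "(\<phi> has_derivative (\<lambda>v. of_real (Re v *\<^sub>R partial_x (partial_x u) z + Im v *\<^sub>R partial_y (partial_x u) z)
        - \<i> * of_real (Re v *\<^sub>R partial_x (partial_y u) z + Im v *\<^sub>R partial_y (partial_y u) z))) (at z)"
      unfolding \<phi>_def 
      by (intro has_derivative_diff has_derivative_mult_right has_derivative_of_real 1)
    then show ?thesis unfolding has_field_derivative_def 
      by (rule has_derivative_eq_rhs) (auto simp: fun_eq_iff complex_eq_iff 2 3 algebra_simps)
  qed
  then have "\<phi> holomorphic_on D"
    using assms(1) field_differentiable_def holomorphic_on_open by blast
  then obtain P where P: "\<And>x. x \<in> D \<Longrightarrow> (P has_field_derivative \<phi> x) (at x within D)"
    using holomorphic_convex_primitive'[OF assms(2,1)] by blast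
  then have P': "\<And>x. x \<in> D \<Longrightarrow> (P has_field_derivative \<phi> x) (at x)"
    using assms(1) at_within_open by metis
  have "((\<lambda>z. u z - Re (P z)) has_derivative (\<lambda>_. 0)) (at z within D)" if z: "z \<in> D" for z
  proof (rule has_derivative_at_withinI)
    have "u differentiable (at z)"
      using h z differentiable_on_eq_differentiable_at[OF assms(1)] by blast
    from has_derivative_diff[OF has_derivative_partials[OF this] 
        bounded_linear.has_derivative[OF bounded_linear_Re P'[OF z, unfolded has_field_derivative_def]]]
    show "((\<lambda>z. u z - Re (P z)) has_derivative (\<lambda>_. 0)) (at z)"
      by (rule has_derivative_eq_rhs) (auto simp: fun_eq_iff \<phi>_def algebra_simps)
  qed
  from has_derivative_zero_constant[OF assms(2) this]
  obtain c where c: "\<And>z. z \<in> D \<Longrightarrow> u z - Re (P z) = c" by blast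
  show thesis
  proof (rule that[of "\<lambda>z. P z + of_real c"])
    have "P holomorphic_on D"
      using P' holomorphic_on_open[OF assms(1)] by blast
    then show "(\<lambda>z. P z + complex_of_real c) holomorphic_on D"
      by (intro holomorphic_on_add holomorphic_on_const)
    show "u z = Re (P z + of_real c)" if "z \<in> D" for z
      using c[OF that] by simp
  qed
next
  case True
  then show thesis using that[of "\<lambda>_. 0"] by simp
qed

lemma harmonic_on_eq_holomorphic_plus_cnj:
  assumes "open D" "convex D" "harmonic_on D f"
  obtains g h where "g holomorphic_on D" "h holomorphic_on D"
    "\<And>z. z \<in> D \<Longrightarrow> f z = g z + cnj (h z)"
proof -
  have H: "real_harmonic_on D (\<lambda>z. Re (f z))" "real_harmonic_on D (\<lambda>z. Im (f z))"
    using assms(3) by (simp_all add: harmonic_on_def)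
  obtain P where P: "P holomorphic_on D" "\<And>z. z \<in> D \<Longrightarrow> Re (f z) = Re (P z)"
    using real_harmonic_on_eq_Re_holomorphic[OF assms(1,2) H(1)] by blast
  obtain Q where Q: "Q holomorphic_on D" "\<And>z. z \<in> D \<Longrightarrow> Im (f z) = Re (Q z)"
    using real_harmonic_on_eq_Re_holomorphic[OF assms(1,2) H(2)] by blast
  show thesis
  proof (rule that[of "\<lambda>z. (P z + \<i> * Q z) / 2" "\<lambda>z. (P z - \<i> * Q z) / 2"])
    \<comment> \<open>With \<open>f = Re P + \<i> Re Q\<close>, replace \<open>Re\<close> by half the sum of the function and its conjugate.\<close>
    show "f z = (P z + \<i> * Q z) / 2 + cnj ((P z - \<i> * Q z) / 2)" if "z \<in> D" for z
      using P(2)[OF that] Q(2)[OF that] by (simp add: complex_eq_iff add_divide_distrib diff_divide_distrib)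
    show "(\<lambda>z. (P z + \<i> * Q z) / 2) holomorphic_on D" "(\<lambda>z. (P z - \<i> * Q z) / 2) holomorphic_on D"
      using P(1) Q(1) by (auto intro!: holomorphic_on_divide holomorphic_on_add holomorphic_on_diff
          holomorphic_on_mult)
  qed
qed

lemma has_derivative_holomorphic_plus_cnj:
  assumes "(g has_field_derivative g') (at z)" "(h has_field_derivative h') (at z)"
  shows "((\<lambda>z. g z + cnj (h z)) has_derivative (\<lambda>v. g' * v + cnj (h' * v))) (at z)"
  using has_derivative_add[OF assms(1)[unfolded has_field_derivative_def]
      bounded_linear.has_derivative[OF bounded_linear_cnj assms(2)[unfolded has_field_derivative_def]]] .

lemma deriv_z_zbar_eq:
  assumes "(f has_derivative (\<lambda>v. a * v + cnj (b * v))) (at z)"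
  shows "deriv_z f z = a" "deriv_zbar f z = cnj b"
  unfolding deriv_z_def deriv_zbar_def partial_x_eq[OF assms] partial_y_eq[OF assms]
  by (simp_all add: algebra_simps)

text \<open>An inequality between continuous functions fails on an open set, which is negligible only if empty.\<close>

lemma AE_le_imp_le_on_open:
  fixes F G :: "'a::euclidean_space \<Rightarrow> real"
  assumes "open D" "continuous_on D F" "continuous_on D G"
    and ae: "AE z in lborel. z \<in> D \<longrightarrow> F z \<le> G z" and "z \<in> D"
  shows "F z \<le> G z"
proof (rule ccontr)
  assume "\<not> F z \<le> G z"
  let ?U = "{w \<in> D. G w < F w}"
  have "open ?U"
  proof -
    have "open (D \<inter> (\<lambda>w. F w - G w) -` {0<..})"
      by (intro continuous_open_preimage continuous_intros assms)
    moreover have "?U = D \<inter> (\<lambda>w. F w - G w) -` {0<..}" by auto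
    ultimately show ?thesis by simp
  qed
  obtain N where N: "{z \<in> space lborel. \<not> (z \<in> D \<longrightarrow> F z \<le> G z)} \<subseteq> N" "emeasure lborel N = 0" "N \<in> sets lborel"
    using AE_E[OF ae] by blast
  have "?U \<subseteq> N" using N(1) by auto
  moreover have "negligible N"
    using N by (auto simp: negligible_iff_null_sets null_sets_def null_sets_completionI)
  ultimately have "negligible ?U" using negligible_subset by blast
  moreover have "?U \<noteq> {}" using assms(5) \<open>\<not> F z \<le> G z\<close> by auto
  ultimately show False using open_not_negligible[OF \<open>open ?U\<close>] by blast
qed

lemma quasiconformal_derivs_le:
  assumes qc: "quasiconformal K D G f" 
    and g: "g holomorphic_on D" and h: "h holomorphic_on D" 
    and f: "\<And>z. z \<in> D \<Longrightarrow> f z = g z + cnj (h z)" and z: "z \<in> D"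
  shows "cmod (deriv g z) + cmod (deriv h z) \<le> K * (cmod (deriv g z) - cmod (deriv h z))"
proof -
  have D: "open D" using qc unfolding quasiconformal_def plane_domain_def by blast
  have *: "grad_norm f z = cmod (deriv g z) + cmod (deriv h z)"
    "grad_conorm f z = cmod (deriv g z) - cmod (deriv h z)" if "z \<in> D" for z
  proof -
    have "((\<lambda>z. g z + cnj (h z)) has_derivative (\<lambda>v. deriv g z * v + cnj (deriv h z * v))) (at z)"
      by (rule has_derivative_holomorphic_plus_cnj holomorphic_derivI[OF g D that] holomorphic_derivI[OF h D that])+
    then have "(f has_derivative (\<lambda>v. deriv g z * v + cnj (deriv h z * v))) (at z)"
      by (rule has_derivative_transform_within_open[OF _ D that]) (simp add: f)
    from deriv_z_zbar_eq[OF this] show "grad_norm f z = cmod (deriv g z) + cmod (deriv h z)"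
    "grad_conorm f z = cmod (deriv g z) - cmod (deriv h z)"
      by (simp_all add: grad_norm_def grad_conorm_def)
  qed
  then have ae: "AE z in lborel. z \<in> D \<longrightarrow> cmod (deriv g z) + cmod (deriv h z) \<le> K * (cmod (deriv g z) - cmod (deriv h z))"
  proof -
    have "AE z in lborel. z \<in> D \<longrightarrow> grad_norm f z \<le> K * grad_conorm f z"
      using qc unfolding quasiconformal_def by blast
    then show ?thesis by (rule eventually_mono) (simp add: *)
  qed
  have "continuous_on D (deriv g)" "continuous_on D (deriv h)"
    using g h D by (simp_all add: holomorphic_on_imp_continuous_on holomorphic_deriv)
  then show ?thesis
    by (intro AE_le_imp_le_on_open[OF D _ _ ae z, rule_format] continuous_on_add continuous_on_diff 
      continuous_on_mult_left continuous_on_norm)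
qed

section \<open>Harmonic quasiconformal homeomorphisms: the lower bound of the derivative by the distance\<close>

text \<open>The hypotheses place \<open>\<delta>\<close> in the closed disk about \<open>\<alpha> * v\<close> whose boundary passes through \<open>0\<close>.\<close>

lemma sense_preserving_Re_ge:
  fixes \<alpha> \<beta> v \<delta> :: complex
  assumes "cmod \<beta> \<le> cmod \<alpha>" "\<alpha> * v + cnj (\<beta> * v) = \<delta>"
  shows "(cmod \<delta>)\<^sup>2 / 2 \<le> Re (cnj \<delta> * (\<alpha> * v))"
proof -
  have "cmod (\<delta> - \<alpha> * v) = cmod (\<beta> * v)"
    using assms(2) by (metis add_diff_cancel_left' complex_mod_cnj)
  also have "\<dots> \<le> cmod (\<alpha> * v)"
    using assms(1) by (simp add: norm_mult mult_right_mono)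
  finally have "(cmod (\<delta> - \<alpha> * v))\<^sup>2 \<le> (cmod (\<alpha> * v))\<^sup>2"
    by (simp add: power_mono)
  moreover have "(cmod (\<delta> - w))\<^sup>2 = (cmod \<delta>)\<^sup>2 - 2 * Re (cnj \<delta> * w) + (cmod w)\<^sup>2" for w
    unfolding cmod_power2 by (simp add: power2_eq_square algebra_simps)
  ultimately show ?thesis by simp
qed

text \<open>A harmonic \<open>K\<close>-quasiconformal homeomorphism \<open>f\<close> with inverse \<open>\<psi>\<close>, given by its decomposition into a
holomorphic and an antiholomorphic part. Since \<open>f\<close> is smooth, the dilatation condition is pointwise.\<close>

locale harmonic_homeomorphism =
  fixes D \<Omega> :: "complex set" and f \<psi> g h :: "complex \<Rightarrow> complex" and K :: real
  assumes open_D: "open D" and connected_D: "connected D" and open_\<Omega>: "open \<Omega>"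
    and homeo: "homeomorphism D \<Omega> f \<psi>"
    and holo_g: "g holomorphic_on D" and holo_h: "h holomorphic_on D"
    and f_eq: "\<And>z. z \<in> D \<Longrightarrow> f z = g z + cnj (h z)"
    and K_ge_1: "K \<ge> 1"
    and dilatation: "\<And>z. z \<in> D \<Longrightarrow>
      cmod (deriv g z) + cmod (deriv h z) \<le> K * (cmod (deriv g z) - cmod (deriv h z))"
begin

lemma f_in: "z \<in> D \<Longrightarrow> f z \<in> \<Omega>" and \<psi>_in: "w \<in> \<Omega> \<Longrightarrow> \<psi> w \<in> D"
  and \<psi>_f: "z \<in> D \<Longrightarrow> \<psi> (f z) = z" and f_\<psi>: "w \<in> \<Omega> \<Longrightarrow> f (\<psi> w) = w"
  and cont_f: "continuous_on D f" and cont_\<psi>: "continuous_on \<Omega> \<psi>"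
  using homeo unfolding homeomorphism_def by auto

lemma deriv_h_le: "z \<in> D \<Longrightarrow> cmod (deriv h z) \<le> cmod (deriv g z)"
  and deriv_g_le: "z \<in> D \<Longrightarrow> cmod (deriv g z) \<le> K * (cmod (deriv g z) - cmod (deriv h z))"
proof -
  assume z: "z \<in> D"
  have "0 \<le> K * (cmod (deriv g z) - cmod (deriv h z))"
    using dilatation[OF z] norm_ge_zero[of "deriv g z"] norm_ge_zero[of "deriv h z"] by linarith
  then show "cmod (deriv h z) \<le> cmod (deriv g z)"
    using K_ge_1 by (simp add: zero_le_mult_iff)
  show "cmod (deriv g z) \<le> K * (cmod (deriv g z) - cmod (deriv h z))"
    using dilatation[OF z] norm_ge_zero[of "deriv h z"] by linarith
qed

lemma has_derivative_f:
  assumes "z \<in> D"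
  shows "(f has_derivative (\<lambda>v. deriv g z * v + cnj (deriv h z * v))) (at z)"
  using has_derivative_holomorphic_plus_cnj[OF holomorphic_derivI[OF holo_g open_D assms]
      holomorphic_derivI[OF holo_h open_D assms]]
  by (rule has_derivative_transform_within_open[OF _ open_D assms]) (simp add: f_eq)

text \<open>The differential of \<open>\<psi>\<close> is characterized by being inverse to that of \<open>f\<close>; its explicit form, Cramer's
rule for \<open>v \<mapsto> \<alpha> v + cnj (\<beta> v)\<close> with Jacobian \<open>J = \<bar>\<alpha>\<bar>\<^sup>2 - \<bar>\<beta>\<bar>\<^sup>2\<close>, is used only in the proof.\<close>

lemma has_derivative_\<psi>:
  assumes w: "w \<in> \<Omega>" and nz: "deriv g (\<psi> w) \<noteq> 0"
  obtains \<psi>' where "(\<psi> has_derivative \<psi>') (at w)"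
    "\<And>\<delta>. deriv g (\<psi> w) * \<psi>' \<delta> + cnj (deriv h (\<psi> w) * \<psi>' \<delta>) = \<delta>"
proof -
  define \<alpha> \<beta> where "\<alpha> = deriv g (\<psi> w)" and "\<beta> = deriv h (\<psi> w)"
  have z: "\<psi> w \<in> D" using w by (rule \<psi>_in)
  define J where "J = \<alpha> * cnj \<alpha> - \<beta> * cnj \<beta>"
  have lt: "cmod \<beta> < cmod \<alpha>"
  proof -
    have "0 < K * (cmod \<alpha> - cmod \<beta>)"
      using deriv_g_le[OF z] nz unfolding \<alpha>_def \<beta>_def by (meson less_le_trans zero_less_norm_iff)
    then show ?thesis using K_ge_1 by (simp add: zero_less_mult_iff)
  qed
  have "J \<noteq> 0"
  proof
    assume "J = 0"
    then have "(cmod \<alpha>)\<^sup>2 = (cmod \<beta>)\<^sup>2"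
      unfolding J_def complex_norm_square[symmetric] by (metis eq_iff_diff_eq_0 of_real_eq_iff)
    then show False using lt by simp
  qed
  define L where "L = (\<lambda>v. (cnj \<alpha> * v - cnj \<beta> * cnj v) / J)"
  have cJ: "cnj J = J" by (simp add: J_def)
  have inv1: "L (\<alpha> * v + cnj (\<beta> * v)) = v" for v
  proof -
    have "cnj \<alpha> * (\<alpha> * v + cnj (\<beta> * v)) - cnj \<beta> * cnj (\<alpha> * v + cnj (\<beta> * v)) = J * v"
      by (simp add: J_def algebra_simps)
    then show ?thesis using \<open>J \<noteq> 0\<close> by (simp add: L_def)
  qed
  have inv2: "\<alpha> * L \<delta> + cnj (\<beta> * L \<delta>) = \<delta>" for \<delta>
  proof -
    have "J * (\<alpha> * L \<delta> + cnj (\<beta> * L \<delta>)) = \<alpha> * (J * L \<delta>) + cnj \<beta> * cnj (J * L \<delta>)"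
      by (simp add: cJ algebra_simps)
    also have "J * L \<delta> = cnj \<alpha> * \<delta> - cnj \<beta> * cnj \<delta>"
      using \<open>J \<noteq> 0\<close> by (simp add: L_def)
    also have "\<alpha> * (cnj \<alpha> * \<delta> - cnj \<beta> * cnj \<delta>) + cnj \<beta> * cnj (cnj \<alpha> * \<delta> - cnj \<beta> * cnj \<delta>) = J * \<delta>"
      by (simp add: J_def algebra_simps)
    finally show ?thesis using \<open>J \<noteq> 0\<close> by simp
  qed
  have bl: "bounded_linear L"
    unfolding L_def
    by (intro bounded_linear_compose[OF bounded_linear_divide] bounded_linear_sub 
        bounded_linear_mult_right bounded_linear_compose[OF bounded_linear_mult_right bounded_linear_cnj])
  have fd: "(f has_derivative (\<lambda>v. \<alpha> * v + cnj (\<beta> * v))) (at (\<psi> w))"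
    using has_derivative_f[OF z] by (simp add: \<alpha>_def \<beta>_def)
  have "(\<psi> has_derivative L) (at w)"
  proof (rule has_derivative_inverse_basic[OF fd bl _ _ open_\<Omega> w f_\<psi>])
    show "L \<circ> (\<lambda>v. \<alpha> * v + cnj (\<beta> * v)) = id"
      by (rule ext) (simp only: o_def inv1 id_def)
    show "isCont \<psi> w" using cont_\<psi> continuous_on_eq_continuous_at[OF open_\<Omega>] w by blast
  qed
  then show thesis using that inv2 unfolding \<alpha>_def \<beta>_def by blast
qed

text \<open>The map \<open>g \<circ> \<psi>\<close> is strongly monotone along segments, by integration of
\<open>sense_preserving_Re_ge\<close>. Only interior points of the segment need to be regular, so that segments
may start or end at the image of a critical point of \<open>g\<close>.\<close>

lemma g_\<psi>_strongly_monotone_on_segment: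
  assumes seg: "closed_segment w1 w2 \<subseteq> \<Omega>"
    and nz: "\<And>w. w \<in> open_segment w1 w2 \<Longrightarrow> deriv g (\<psi> w) \<noteq> 0"
  shows "(cmod (w2 - w1))\<^sup>2 / 2 \<le> Re (cnj (w2 - w1) * (g (\<psi> w2) - g (\<psi> w1)))"
proof (cases "w1 = w2")
  case False
  define \<delta> where "\<delta> = w2 - w1"
  define p where "p = (\<lambda>t::real. w1 + of_real t * \<delta>)"
  have p_seg: "p t \<in> closed_segment w1 w2" if "0 \<le> t" "t \<le> 1" for t
    using that unfolding closed_segment_def p_def \<delta>_def
    by (auto intro!: exI[of _ t] simp: scaleR_conv_of_real algebra_simps)
  have p_oseg: "p t \<in> open_segment w1 w2" if "0 < t" "t < 1" for t
    using that False unfolding in_segment p_def \<delta>_def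
    by (auto intro!: exI[of _ t] simp: scaleR_conv_of_real algebra_simps)
  define F where "F = (\<lambda>t. Re (cnj \<delta> * g (\<psi> (p t))) - t * ((cmod \<delta>)\<^sup>2 / 2))"
  have F_deriv: "\<exists>y. (F has_field_derivative y) (at t) \<and> 0 \<le> y" if t: "0 < t" "t < 1" for t
  proof -
    have w: "p t \<in> \<Omega>" and nzt: "deriv g (\<psi> (p t)) \<noteq> 0"
      using seg p_seg[of t] nz[OF p_oseg[OF t]] t by auto
    obtain \<psi>' where \<psi>': "(\<psi> has_derivative \<psi>') (at (p t))"
      "\<And>\<delta>. deriv g (\<psi> (p t)) * \<psi>' \<delta> + cnj (deriv h (\<psi> (p t)) * \<psi>' \<delta>) = \<delta>"
      using has_derivative_\<psi>[OF w nzt] by blast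
    have "(p has_derivative (\<lambda>s. of_real s * \<delta>)) (at t)"
      unfolding p_def by (auto intro!: derivative_eq_intros)
    from has_derivative_compose[OF has_derivative_compose[OF this \<psi>'(1)] 
        holomorphic_derivI[OF holo_g open_D \<psi>_in[OF w], unfolded has_field_derivative_def]]
    have "((\<lambda>t. g (\<psi> (p t))) has_derivative (\<lambda>s. deriv g (\<psi> (p t)) * \<psi>' (of_real s * \<delta>))) (at t)" .
    also have "(\<lambda>s. deriv g (\<psi> (p t)) * \<psi>' (of_real s * \<delta>)) = (\<lambda>s. s *\<^sub>R (deriv g (\<psi> (p t)) * \<psi>' \<delta>))"
    proof
      fix s show "deriv g (\<psi> (p t)) * \<psi>' (of_real s * \<delta>) = s *\<^sub>R (deriv g (\<psi> (p t)) * \<psi>' \<delta>)"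
        using linear_cmul[OF has_derivative_linear[OF \<psi>'(1)], of s \<delta>] by (simp add: scaleR_conv_of_real)
    qed
    finally have "((\<lambda>t. g (\<psi> (p t))) has_vector_derivative deriv g (\<psi> (p t)) * \<psi>' \<delta>) (at t)"
      by (simp add: has_vector_derivative_def)
    then have "((\<lambda>t. Re (cnj \<delta> * g (\<psi> (p t)))) has_vector_derivative Re (cnj \<delta> * (deriv g (\<psi> (p t)) * \<psi>' \<delta>))) (at t)"
      by (intro bounded_linear.has_vector_derivative[OF bounded_linear_Re] has_vector_derivative_mult_right)
    then have "((\<lambda>t. Re (cnj \<delta> * g (\<psi> (p t)))) has_field_derivative Re (cnj \<delta> * (deriv g (\<psi> (p t)) * \<psi>' \<delta>))) (at t)"
      by (simp add: has_real_derivative_iff_has_vector_derivative)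
    then have "(F has_field_derivative Re (cnj \<delta> * (deriv g (\<psi> (p t)) * \<psi>' \<delta>)) - (cmod \<delta>)\<^sup>2 / 2) (at t)"
      unfolding F_def by (rule DERIV_diff) (auto intro!: derivative_eq_intros)
    moreover have "0 \<le> Re (cnj \<delta> * (deriv g (\<psi> (p t)) * \<psi>' \<delta>)) - (cmod \<delta>)\<^sup>2 / 2"
      using sense_preserving_Re_ge[OF deriv_h_le[OF \<psi>_in[OF w]] \<psi>'(2)[of \<delta>]] by simp
    ultimately show ?thesis by blast
  qed
  have F_cont: "continuous_on {0..1} F"
  proof -
    have "continuous_on {0..1} p" unfolding p_def by (intro continuous_intros)
    moreover have "p ` {0..1} \<subseteq> \<Omega>" using p_seg seg by auto
    ultimately have "continuous_on {0..1} (\<lambda>t. \<psi> (p t))"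
      using continuous_on_compose2[OF cont_\<psi>] by blast
    moreover have "(\<lambda>t. \<psi> (p t)) ` {0..1} \<subseteq> D" using \<open>p ` {0..1} \<subseteq> \<Omega>\<close> \<psi>_in by auto
    ultimately have "continuous_on {0..1} (\<lambda>t. g (\<psi> (p t)))"
      using continuous_on_compose2[OF holomorphic_on_imp_continuous_on[OF holo_g]] by blast
    then show ?thesis
      unfolding F_def by (intro continuous_intros)
  qed
  have "F 0 \<le> F 1"
    using DERIV_nonneg_imp_increasing_open[OF _ F_deriv F_cont] by simp
  then show ?thesis by (simp add: F_def p_def \<delta>_def algebra_simps)
qed simp

text \<open>One exceptional point is allowed because this is applied around the image of a possible zero of
\<open>g'\<close>, in order to exclude such zeros. A segment through the exceptional point is cut there, and the
two monotonicity inequalities add up.\<close>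

lemma g_\<psi>_strongly_monotone:
  assumes C: "convex C" "C \<subseteq> \<Omega>"
    and nz: "\<And>w. w \<in> C - {wc} \<Longrightarrow> deriv g (\<psi> w) \<noteq> 0"
    and w: "w1 \<in> C" "w2 \<in> C"
  shows "(cmod (w2 - w1))\<^sup>2 / 2 \<le> Re (cnj (w2 - w1) * (g (\<psi> w2) - g (\<psi> w1)))"
proof (cases "wc \<in> open_segment w1 w2")
  case False
  have "closed_segment w1 w2 \<subseteq> C" using C w by (simp add: closed_segment_subset)
  with False show ?thesis
    using C nz by (intro g_\<psi>_strongly_monotone_on_segment) (auto simp: open_segment_def)
next
  case True
  then obtain t where t: "0 < t" "t < 1" and wc: "wc = w1 + of_real t * (w2 - w1)"
    unfolding in_segment by (auto simp: scaleR_conv_of_real algebra_simps)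
  have w0C: "wc \<in> C" using True C w closed_segment_subset[of w1 C w2] by (auto simp: open_segment_def)
  have ne: "w1 \<noteq> w2" using True by auto
  have "closed_segment w1 wc \<subseteq> C" "closed_segment wc w2 \<subseteq> C" 
    using C w w0C by (simp_all add: closed_segment_subset)
  then have 1: "(cmod (wc - w1))\<^sup>2 / 2 \<le> Re (cnj (wc - w1) * (g (\<psi> wc) - g (\<psi> w1)))"
    "(cmod (w2 - wc))\<^sup>2 / 2 \<le> Re (cnj (w2 - wc) * (g (\<psi> w2) - g (\<psi> wc)))"
    using C nz by (intro g_\<psi>_strongly_monotone_on_segment; auto simp: open_segment_def)+
  define \<delta> A B where "\<delta> = w2 - w1" and "A = g (\<psi> wc) - g (\<psi> w1)" and "B = g (\<psi> w2) - g (\<psi> wc)"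
  define u where "u = 1 - t"
  have u: "0 < u" using t by (simp add: u_def)
  have 2: "wc - w1 = of_real t * \<delta>" "w2 - wc = of_real u * \<delta>"
    by (simp_all add: wc \<delta>_def u_def algebra_simps)
  have "t * (t * (cmod \<delta>)\<^sup>2 / 2) \<le> t * Re (cnj \<delta> * A)"
    using 1(1) t unfolding 2 A_def[symmetric]
    by (simp add: norm_mult power_mult_distrib power2_eq_square algebra_simps)
  then have a: "t * (cmod \<delta>)\<^sup>2 / 2 \<le> Re (cnj \<delta> * A)" using t by (simp only: mult_le_cancel_left_pos)
  have "u * (u * (cmod \<delta>)\<^sup>2 / 2) \<le> u * Re (cnj \<delta> * B)"
    using 1(2) u unfolding 2 B_def[symmetric]
    by (simp add: norm_mult power_mult_distrib power2_eq_square algebra_simps)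
  then have b: "u * (cmod \<delta>)\<^sup>2 / 2 \<le> Re (cnj \<delta> * B)" using u by (simp only: mult_le_cancel_left_pos)
  have "(cmod \<delta>)\<^sup>2 / 2 = t * (cmod \<delta>)\<^sup>2 / 2 + u * (cmod \<delta>)\<^sup>2 / 2" by (simp add: u_def field_simps)
  also have "\<dots> \<le> Re (cnj \<delta> * A) + Re (cnj \<delta> * B)" using a b by linarith
  also have "\<dots> = Re (cnj \<delta> * (g (\<psi> w2) - g (\<psi> w1)))" by (simp add: A_def B_def algebra_simps)
  finally show ?thesis unfolding \<delta>_def .
qed

lemma dist_g_\<psi>_ge:
  assumes "convex C" "C \<subseteq> \<Omega>" "\<And>w. w \<in> C - {wc} \<Longrightarrow> deriv g (\<psi> w) \<noteq> 0" "w1 \<in> C" "w2 \<in> C"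
  shows "cmod (w2 - w1) / 2 \<le> cmod (g (\<psi> w2) - g (\<psi> w1))"
proof (cases "w1 = w2")
  case False
  have "cmod (w2 - w1) * (cmod (w2 - w1) / 2) \<le> Re (cnj (w2 - w1) * (g (\<psi> w2) - g (\<psi> w1)))"
    using g_\<psi>_strongly_monotone[where wc = wc, OF assms] by (simp add: power2_eq_square)
  also have "\<dots> \<le> cmod (w2 - w1) * cmod (g (\<psi> w2) - g (\<psi> w1))"
    by (rule order_trans[OF complex_Re_le_cmod]) (simp only: norm_mult complex_mod_cnj order_refl)
  finally show ?thesis using False by (simp only: mult_le_cancel_left_pos zero_less_norm_iff right_minus_eq not_sym)
qed simp

lemma open_\<psi>_image: "open U \<Longrightarrow> U \<subseteq> \<Omega> \<Longrightarrow> open (\<psi> ` U)"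
proof -
  assume U: "open U" "U \<subseteq> \<Omega>"
  have "\<psi> ` U = D \<inter> f -` U" using U \<psi>_in f_\<psi> \<psi>_f by force
  then show "open (\<psi> ` U)" using continuous_open_preimage[OF cont_f open_D U(1)] by simp
qed

text \<open>A version of Lewy's theorem on the Jacobian of univalent harmonic maps. Near a zero \<open>z0\<close> of \<open>g'\<close> there
are no other zeros, so \<open>g \<circ> \<psi>\<close> is strongly monotone on a ball around \<open>f z0\<close>; thus \<open>g\<close> is injective
near \<open>z0\<close>, which contradicts \<open>g' z0 = 0\<close>.\<close>

lemma deriv_g_nonzero:
  assumes z0: "z0 \<in> D"
  shows "deriv g z0 \<noteq> 0"
proof
  assume crit: "deriv g z0 = 0"
  have hol: "deriv g holomorphic_on D" using holo_g open_D by (rule holomorphic_deriv)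
  \<comment> \<open>Zeros of \<open>g'\<close> are isolated, for otherwise \<open>g'\<close>, hence \<open>h'\<close>, vanishes identically and \<open>f\<close> is constant.\<close>
  have "\<exists>z1\<in>D. deriv g z1 \<noteq> 0"
  proof (rule ccontr)
    assume "\<not> ?thesis"
    then have 0: "deriv g z = 0" "deriv h z = 0" if "z \<in> D" for z
      using that deriv_h_le[OF that] by auto
    have "(f has_derivative (\<lambda>v. 0)) (at z)" if "z \<in> D" for z
      using has_derivative_f[OF that] by (simp add: 0 that)
    then have "f z = f z0" if "z \<in> D" for z
      using has_derivative_zero_unique_connected[OF open_D connected_D _ z0 that, of f] by auto
    then have "D \<subseteq> {z0}" using \<psi>_f z0 by (metis singletonI subsetI)
    then have "D = {z0}" using z0 by blast
    then show False using open_D not_open_singleton by blast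
  qed
  then obtain z1 where z1: "z1 \<in> D" "deriv g z1 \<noteq> 0" by blast
  obtain r where r: "0 < r" "ball z0 r \<subseteq> D" "\<And>z. z \<in> ball z0 r - {z0} \<Longrightarrow> deriv g z \<noteq> 0"
    using isolated_zeros[OF hol open_D connected_D z0 crit z1] by blast
  have "open (\<Omega> \<inter> \<psi> -` ball z0 r)"
    by (rule continuous_open_preimage[OF cont_\<psi> open_\<Omega> open_ball])
  moreover have "f z0 \<in> \<Omega> \<inter> \<psi> -` ball z0 r" using z0 r f_in \<psi>_f by auto
  ultimately obtain e where e: "e > 0" "ball (f z0) e \<subseteq> \<Omega> \<inter> \<psi> -` ball z0 r"
    using open_contains_ball_eq by blast
  have nz: "deriv g (\<psi> w) \<noteq> 0" if "w \<in> ball (f z0) e - {f z0}" for w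
  proof -
    have "w \<in> \<Omega>" "\<psi> w \<in> ball z0 r" using that e by auto
    moreover have "\<psi> w \<noteq> z0" using that f_\<psi>[OF \<open>w \<in> \<Omega>\<close>] by auto
    ultimately show ?thesis using r(3) by blast
  qed
  have sub: "ball (f z0) e \<subseteq> \<Omega>" using e by blast
  have "inj_on g (\<psi> ` ball (f z0) e)"
  proof (rule inj_onI, clarify)
    fix w1 w2 assume w: "w1 \<in> ball (f z0) e" "w2 \<in> ball (f z0) e" "g (\<psi> w1) = g (\<psi> w2)"
    have "cmod (w2 - w1) / 2 \<le> cmod (g (\<psi> w2) - g (\<psi> w1))"
      using dist_g_\<psi>_ge[where wc = "f z0", OF convex_ball sub nz w(1,2)] .
    then show "\<psi> w1 = \<psi> w2" using w(3) by simp
  qed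
  moreover have "open (\<psi> ` ball (f z0) e)" using open_\<psi>_image sub by blast
  moreover have "g holomorphic_on \<psi> ` ball (f z0) e"
    using holo_g by (rule holomorphic_on_subset) (use sub \<psi>_in in auto)
  moreover have "z0 \<in> \<psi> ` ball (f z0) e" using e(1) by (intro image_eqI[of _ _ "f z0"]) (simp_all add: \<psi>_f[OF z0])
  ultimately show False using holomorphic_injective_imp_regular crit by blast
qed

lemma \<psi>_Lipschitz_on_segment:
  assumes m: "m > 0" "\<And>z. z \<in> D \<Longrightarrow> m \<le> cmod (deriv g z)"
    and seg: "closed_segment w1 w2 \<subseteq> \<Omega>"
  shows "cmod (\<psi> w1 - \<psi> w2) \<le> K / m * cmod (w1 - w2)"
proof -
  have "\<exists>\<psi>'. (\<psi> has_derivative \<psi>') (at w within closed_segment w1 w2) \<and> onorm \<psi>' \<le> K / m" 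
    if "w \<in> closed_segment w1 w2" for w
  proof -
    have w: "w \<in> \<Omega>" using that seg by blast
    then have z: "\<psi> w \<in> D" by (rule \<psi>_in)
    obtain \<psi>' where \<psi>': "(\<psi> has_derivative \<psi>') (at w)"
      "\<And>\<delta>. deriv g (\<psi> w) * \<psi>' \<delta> + cnj (deriv h (\<psi> w) * \<psi>' \<delta>) = \<delta>"
      using has_derivative_\<psi>[OF w deriv_g_nonzero[OF z]] by blast
    have "cmod (\<psi>' \<delta>) \<le> K / m * cmod \<delta>" for \<delta>
    proof -
      define \<alpha> \<beta> where "\<alpha> = cmod (deriv g (\<psi> w))" and "\<beta> = cmod (deriv h (\<psi> w))"
      have "m * cmod (\<psi>' \<delta>) \<le> \<alpha> * cmod (\<psi>' \<delta>)"
        unfolding \<alpha>_def by (intro mult_right_mono m z) simp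
      also have "\<dots> \<le> K * (\<alpha> - \<beta>) * cmod (\<psi>' \<delta>)"
        using deriv_g_le[OF z] unfolding \<alpha>_def \<beta>_def by (intro mult_right_mono) simp_all
      also have "\<dots> = K * (cmod (deriv g (\<psi> w) * \<psi>' \<delta>) - cmod (cnj (deriv h (\<psi> w) * \<psi>' \<delta>)))"
        unfolding \<alpha>_def \<beta>_def complex_mod_cnj norm_mult by (simp add: algebra_simps)
      also have "\<dots> \<le> K * cmod \<delta>"
        using K_ge_1 norm_diff_ineq[of "deriv g (\<psi> w) * \<psi>' \<delta>" "cnj (deriv h (\<psi> w) * \<psi>' \<delta>)"]
        unfolding \<psi>'(2)[of \<delta>] by (intro mult_left_mono) auto
      finally show ?thesis using m(1) by (simp add: field_simps)
    qed
    then have "onorm \<psi>' \<le> K / m" by (rule onorm_le)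
    then show ?thesis using \<psi>'(1) has_derivative_at_withinI by blast
  qed
  then obtain \<Psi> where "\<And>w. w \<in> closed_segment w1 w2 \<Longrightarrow> 
      (\<psi> has_derivative \<Psi> w) (at w within closed_segment w1 w2) \<and> onorm (\<Psi> w) \<le> K / m"
    by metis
  then show ?thesis
    using differentiable_bound[of "closed_segment w1 w2" \<psi> \<Psi> "K / m" w1 w2] by auto
qed

end

lemma deriv_Moebius_function_self:
  assumes "cmod z < 1"
  shows "(Moebius_function 0 z has_field_derivative of_real (1 / (1 - (cmod z)\<^sup>2))) (at z)"
proof -
  have *: "1 - cnj z * z = of_real (1 - (cmod z)\<^sup>2)"
    unfolding of_real_diff complex_norm_square by (simp add: mult.commute)
  have "(cmod z)\<^sup>2 < 1" using assms by (simp add: power_less_one_iff)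
  then have nz: "1 - cnj z * z \<noteq> 0" unfolding * of_real_eq_0_iff by simp
  have "((\<lambda>\<zeta>. (\<zeta> - z) / (1 - cnj z * \<zeta>)) has_field_derivative 1 / (1 - cnj z * z)) (at z)"
    using nz by (auto intro!: derivative_eq_intros)
  then show ?thesis
    unfolding * by (simp add: Moebius_function_simple[abs_def] )
qed

text \<open>The map \<open>g\<close> is univalent on the preimage of the ball, with an image that contains the ball of radius
\<open>d / 2\<close> about \<open>g z\<close> since \<open>g \<circ> \<psi>\<close> at most halves distances. The inverse of \<open>g\<close> maps the latter ball
into the unit disk, so that the Schwarz--Pick lemma bounds its derivative.\<close>

lemma (in harmonic_homeomorphism) deriv_g_ge_dist:
  assumes disc: "D = ball 0 1" and z: "z \<in> D" and d: "ball (f z) d \<subseteq> \<Omega>"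
  shows "d / 2 \<le> cmod (deriv g z) * (1 - (cmod z)\<^sup>2)"
proof -
  have z1: "cmod z < 1" using z disc by simp
  then have z2: "(cmod z)\<^sup>2 < 1" by (simp add: power_less_one_iff)
  have nz: "deriv g (\<psi> w) \<noteq> 0" if "w \<in> ball (f z) d - {f z}" for w
    using that d \<psi>_in deriv_g_nonzero by blast
  \<comment> \<open>Smaller radii keep the closed ball inside \<open>\<Omega>\<close>, where \<open>g \<circ> \<psi>\<close> is continuous.\<close>
  have main: "s / 2 \<le> cmod (deriv g z) * (1 - (cmod z)\<^sup>2)" if s: "0 < s" "s < d" for s
  proof -
    let ?B = "ball (f z) s" and ?\<Theta> = "\<lambda>w. g (\<psi> w)"
    have sub: "?B \<subseteq> ball (f z) d" "cball (f z) s \<subseteq> ball (f z) d" using s by auto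
    have ge: "cmod (w2 - w1) / 2 \<le> cmod (?\<Theta> w2 - ?\<Theta> w1)" if "w1 \<in> ball (f z) d" "w2 \<in> ball (f z) d" for w1 w2
      using dist_g_\<psi>_ge[where wc = "f z", OF convex_ball d nz that] .
    define V where "V = \<psi> ` ?B"
    have V: "open V" "V \<subseteq> D" 
      using open_\<psi>_image[of ?B] sub d \<psi>_in unfolding V_def by auto
    have zV: "z \<in> V" using s unfolding V_def by (intro image_eqI[of _ _ "f z"]) (simp_all add: \<psi>_f[OF z])
    have gV: "g holomorphic_on V" using holo_g V(2) by (rule holomorphic_on_subset)
    have inj: "inj_on g V"
    proof (unfold V_def, rule inj_onI, clarify)
      fix w1 w2 assume w: "w1 \<in> ?B" "w2 \<in> ?B" "?\<Theta> w1 = ?\<Theta> w2"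
      have "cmod (w2 - w1) / 2 \<le> cmod (?\<Theta> w2 - ?\<Theta> w1)" using ge w sub by blast
      then show "\<psi> w1 = \<psi> w2" using w(3) by simp
    qed
    obtain \<kappa> where \<kappa>: "\<kappa> holomorphic_on (g ` V)" "\<And>v. v \<in> V \<Longrightarrow> deriv g v * deriv \<kappa> (g v) = 1"
      "\<And>v. v \<in> V \<Longrightarrow> \<kappa> (g v) = v"
      using holomorphic_has_inverse[OF gV V(1) inj] by blast
    have gVo: "open (g ` V)" using open_mapping_thm3[OF gV V(1) inj] .
    have img: "ball (g z) (s / 2) \<subseteq> g ` V"
    proof -
      have "ball (?\<Theta> (f z)) (s / 2) \<subseteq> ?\<Theta> ` ?B"
      proof (rule ball_subset_open_map_image)
        have "continuous_on (cball (f z) s) \<psi>" using cont_\<psi> sub d continuous_on_subset by blast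
        moreover have "\<psi> ` cball (f z) s \<subseteq> D" using \<psi>_in sub d by auto
        ultimately have "continuous_on (cball (f z) s) ?\<Theta>"
          using continuous_on_compose2[OF holomorphic_on_imp_continuous_on[OF holo_g]] by blast
        then show "continuous_on (closure ?B) ?\<Theta>" using s by simp
        show "open (?\<Theta> ` interior ?B)" using gVo by (simp add: V_def image_image)
        show "s / 2 \<le> cmod (?\<Theta> w - ?\<Theta> (f z))" if "w \<in> frontier ?B" for w
        proof -
          have "dist (f z) w = s" using that s by simp
          then show ?thesis using ge[of "f z" w] s by (simp add: dist_norm norm_minus_commute)
        qed
      qed (use s in auto)
      then show ?thesis using \<psi>_f[OF z] by (simp add: V_def image_image)
    qed
    let ?A = "\<lambda>\<zeta>. g z + of_real (s / 2) * \<zeta>"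
    let ?M = "Moebius_function 0 z"
    \<comment> \<open>The inverse of \<open>g\<close>, normalized to a self-map of the unit disk that fixes \<open>0\<close>.\<close>
    define F where "F = (\<lambda>\<zeta>. ?M (\<kappa> (?A \<zeta>)))"
    have A_in: "?A \<zeta> \<in> g ` V" if "cmod \<zeta> < 1" for \<zeta>
    proof -
      have "dist (g z) (?A \<zeta>) = s / 2 * cmod \<zeta>" using s by (simp add: dist_norm norm_mult)
      also have "\<dots> < s / 2" using that s by simp
      finally show ?thesis using img by auto
    qed
    have \<kappa>_in: "\<kappa> (?A \<zeta>) \<in> ball 0 1" if "cmod \<zeta> < 1" for \<zeta>
      using A_in[OF that] \<kappa>(3) V(2) disc by fastforce
    have "(\<lambda>\<zeta>. \<kappa> (?A \<zeta>)) holomorphic_on ball 0 1"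
    proof -
      have "?A holomorphic_on ball 0 1" by (intro holomorphic_intros)
      moreover have "?A ` ball 0 1 \<subseteq> g ` V" using A_in by auto
      ultimately show ?thesis
        using holomorphic_on_compose_gen[OF _ \<kappa>(1), of ?A] by (simp add: o_def)
    qed
    moreover have "(\<lambda>\<zeta>. \<kappa> (?A \<zeta>)) ` ball 0 1 \<subseteq> ball 0 1"
      by (rule image_subsetI, rule \<kappa>_in) (simp only: mem_ball_0)
    ultimately have "F holomorphic_on ball 0 1"
      unfolding F_def using holomorphic_on_compose_gen[OF _ Moebius_function_holomorphic[OF z1, of 0]]
      unfolding o_def by blast
    moreover have "F 0 = 0" using \<kappa>(3)[OF zV] by (simp add: F_def Moebius_function_eq_zero)
    moreover have "cmod (F \<zeta>) < 1" if "cmod \<zeta> < 1" for \<zeta>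
      using \<kappa>_in[OF that] Moebius_function_norm_lt_1[OF z1] by (simp add: F_def)
    ultimately have le: "cmod (deriv F 0) \<le> 1"
      using Schwarz_Lemma(2)[of F 0] by simp
    have "(\<kappa> has_field_derivative deriv \<kappa> (g z)) (at (g z))"
      using \<kappa>(1) gVo zV by (intro holomorphic_derivI) auto
    then have "(\<kappa> has_field_derivative deriv \<kappa> (g z)) (at (?A 0))" by simp
    moreover have "(?A has_field_derivative of_real (s / 2)) (at 0)"
      by (auto intro!: derivative_eq_intros)
    ultimately have "((\<lambda>\<zeta>. \<kappa> (?A \<zeta>)) has_field_derivative deriv \<kappa> (g z) * of_real (s / 2)) (at 0)"
      by (rule DERIV_chain2)
    moreover have "(?M has_field_derivative of_real (1 / (1 - (cmod z)\<^sup>2))) (at (\<kappa> (?A 0)))"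
      using deriv_Moebius_function_self[OF z1] \<kappa>(3)[OF zV] by simp
    ultimately have "(F has_field_derivative of_real (1 / (1 - (cmod z)\<^sup>2)) * (deriv \<kappa> (g z) * of_real (s / 2))) (at 0)"
      unfolding F_def by (rule DERIV_chain2[rotated])
    then have "deriv F 0 = of_real (1 / (1 - (cmod z)\<^sup>2)) * (deriv \<kappa> (g z) * of_real (s / 2))"
      by (rule DERIV_imp_deriv)
    then have "cmod (deriv F 0) = cmod (deriv \<kappa> (g z)) * (s / 2) / (1 - (cmod z)\<^sup>2)"
      using s z2 by (simp only: norm_mult norm_of_real) simp
    with le have 1: "cmod (deriv \<kappa> (g z)) * (s / 2) \<le> 1 - (cmod z)\<^sup>2"
      using z2 by (simp add: field_simps)
    have "s / 2 = cmod (deriv g z * deriv \<kappa> (g z)) * (s / 2)"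
      using \<kappa>(2)[OF zV] by simp
    also have "\<dots> = cmod (deriv g z) * (cmod (deriv \<kappa> (g z)) * (s / 2))" by (simp add: norm_mult)
    also have "\<dots> \<le> cmod (deriv g z) * (1 - (cmod z)\<^sup>2)" using 1 by (intro mult_left_mono) auto
    finally show ?thesis .
  qed
  show ?thesis
  proof (cases "d > 0")
    case True
    have "d \<le> 2 * (cmod (deriv g z) * (1 - (cmod z)\<^sup>2))"
      by (rule dense_le_bounded[OF True]) (use main in fastforce)
    then show ?thesis by simp
  next
    case False
    moreover have "0 \<le> cmod (deriv g z) * (1 - (cmod z)\<^sup>2)" using z2 by simp
    ultimately show ?thesis by linarith
  qed
qed

section \<open>A subharmonic barrier\<close>

lemma second_derivative_test_max:
  fixes \<phi> \<phi>' :: "real \<Rightarrow> real"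
  assumes "e > 0"
    and d1: "\<And>t. \<bar>t\<bar> < e \<Longrightarrow> (\<phi> has_real_derivative \<phi>' t) (at t)"
    and d2: "(\<phi>' has_real_derivative s) (at 0)"
    and max: "\<And>t. \<bar>t\<bar> < e \<Longrightarrow> \<phi> t \<le> \<phi> 0"
  shows "s \<le> 0"
proof (rule ccontr)
  assume "\<not> s \<le> 0"
  then obtain d where d: "d > 0" "\<And>t. 0 < t \<Longrightarrow> t < d \<Longrightarrow> \<phi>' 0 < \<phi>' t"
    using DERIV_pos_inc_right[OF d2] by auto
  have "\<phi>' 0 = 0"
    by (rule DERIV_local_max[OF d1 assms(1)]) (use max assms(1) in auto)
  define t where "t = min d e / 2"
  have t: "0 < t" "t < d" "t < e" using d(1) assms(1) by (auto simp: t_def min_def)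
  obtain \<xi> where "0 < \<xi>" "\<xi> < t" "\<phi> t - \<phi> 0 = (t - 0) * \<phi>' \<xi>"
    using MVT2[OF t(1), of \<phi> \<phi>'] d1 t by auto
  moreover have "\<phi>' \<xi> > 0" using d(2)[of \<xi>] calculation t \<open>\<phi>' 0 = 0\<close> by simp
  ultimately have "\<phi> t > \<phi> 0" using t(1) by (simp add: algebra_simps)
  with max[of t] t show False by simp
qed

lemma exp_neg_sq_derivatives:
  fixes a b a' b' :: "real \<Rightarrow> real"
  assumes "\<And>t. \<bar>t\<bar> < e \<Longrightarrow> (a has_real_derivative a' t) (at t)" 
    and "\<And>t. \<bar>t\<bar> < e \<Longrightarrow> (b has_real_derivative b' t) (at t)"
    and "(a' has_real_derivative a'') (at 0)" "(b' has_real_derivative b'') (at 0)" and "e > 0"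
  shows "\<And>t. \<bar>t\<bar> < e \<Longrightarrow> ((\<lambda>t. exp (- (l * ((a t)\<^sup>2 + (b t)\<^sup>2)))) has_real_derivative
      - (2 * l) * (exp (- (l * ((a t)\<^sup>2 + (b t)\<^sup>2))) * (a t * a' t + b t * b' t))) (at t)" (is "\<And>t. _ \<Longrightarrow> ?A t")
    and "((\<lambda>t. - (2 * l) * (exp (- (l * ((a t)\<^sup>2 + (b t)\<^sup>2))) * (a t * a' t + b t * b' t))) has_real_derivative
      2 * l * exp (- (l * ((a 0)\<^sup>2 + (b 0)\<^sup>2))) *
       (2 * l * (a 0 * a' 0 + b 0 * b' 0)\<^sup>2 - ((a' 0)\<^sup>2 + (b' 0)\<^sup>2 + a 0 * a'' + b 0 * b''))) (at 0)" (is ?B)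
proof -
  have *: "((\<lambda>t. exp (- (l * ((a t)\<^sup>2 + (b t)\<^sup>2)))) has_real_derivative
      - (2 * l) * (exp (- (l * ((a t)\<^sup>2 + (b t)\<^sup>2))) * (a t * a' t + b t * b' t))) (at t)" if "\<bar>t\<bar> < e" for t
    by (rule derivative_eq_intros assms(1)[OF that] assms(2)[OF that] refl)+ (simp add: algebra_simps)
  then show "\<And>t. \<bar>t\<bar> < e \<Longrightarrow> ?A t" .
  have 0: "\<bar>0\<bar> < e" using assms(5) by simp
  show ?B
    by (rule derivative_eq_intros *[OF 0] assms(1)[OF 0] assms(2)[OF 0] assms(3,4) refl)+
      (simp add: algebra_simps power2_eq_square)
qed

text \<open>The second derivative at \<open>0\<close> of \<open>t \<mapsto> exp (- l \<bar>\<phi> t\<bar>\<^sup>2)\<close> for a curve \<open>\<phi>\<close> with \<open>\<phi> 0 = w\<close>, \<open>\<phi>' 0 = w'\<close> and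
\<open>\<phi>'' 0 = w''\<close>. The sum over a horizontal and a vertical line is the Laplacian.\<close>

definition line_Laplacian_term :: "real \<Rightarrow> complex \<Rightarrow> complex \<Rightarrow> complex \<Rightarrow> real" where
  "line_Laplacian_term l w w' w'' = 2 * l * exp (- (l * (cmod w)\<^sup>2)) *
     (2 * l * (Re (cnj w * w'))\<^sup>2 - ((cmod w')\<^sup>2 + Re (cnj w * w'')))"

lemma exp_neg_norm_sq_derivatives:
  fixes \<phi> \<phi>' :: "real \<Rightarrow> complex"
  assumes "\<And>t. \<bar>t\<bar> < e \<Longrightarrow> (\<phi> has_vector_derivative \<phi>' t) (at t)" 
    and "(\<phi>' has_vector_derivative \<phi>'') (at 0)" and "e > 0"
  obtains E where "\<And>t. \<bar>t\<bar> < e \<Longrightarrow> ((\<lambda>t. exp (- (l * (cmod (\<phi> t))\<^sup>2))) has_real_derivative E t) (at t)"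
    "(E has_real_derivative line_Laplacian_term l (\<phi> 0) (\<phi>' 0) \<phi>'') (at 0)"
proof -
  have R: "((\<lambda>t. Re (p t)) has_real_derivative Re p') (at t)" "((\<lambda>t. Im (p t)) has_real_derivative Im p') (at t)"
    if "(p has_vector_derivative p') (at t)" for p p' t
    using that by (simp_all add: has_vector_derivative_complex_iff has_real_derivative_iff_has_vector_derivative)
  note X = exp_neg_sq_derivatives[OF R(1)[OF assms(1)] R(2)[OF assms(1)] R(1)[OF assms(2)] R(2)[OF assms(2)] assms(3), where l = l]
  show thesis
  proof (rule that)
    show "((\<lambda>t. exp (- (l * (cmod (\<phi> t))\<^sup>2))) has_real_derivative
       - (2 * l) * (exp (- (l * ((Re (\<phi> t))\<^sup>2 + (Im (\<phi> t))\<^sup>2))) * (Re (\<phi> t) * Re (\<phi>' t) + Im (\<phi> t) * Im (\<phi>' t)))) (at t)"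
      if "\<bar>t\<bar> < e" for t
      using X(1)[OF _ _ that] by (simp add: cmod_power2)
    show "((\<lambda>t. - (2 * l) * (exp (- (l * ((Re (\<phi> t))\<^sup>2 + (Im (\<phi> t))\<^sup>2))) * (Re (\<phi> t) * Re (\<phi>' t) + Im (\<phi> t) * Im (\<phi>' t))))
        has_real_derivative line_Laplacian_term l (\<phi> 0) (\<phi>' 0) \<phi>'') (at 0)"
      using X(2) by (simp add: line_Laplacian_term_def cmod_power2 algebra_simps)
  qed
qed

text \<open>The Laplacian of \<open>exp (- l \<bar>F\<bar>\<^sup>2)\<close> for a harmonic \<open>F = g + cnj h\<close> with value \<open>w\<close> and with \<open>\<alpha>\<close>, \<open>\<beta>\<close> for
\<open>g'\<close>, \<open>h'\<close>. Harmonicity enters through the opposite signs of the second derivatives in the two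
directions. The term \<open>\<alpha> * cnj w + \<beta> * w\<close> is the derivative \<open>\<partial>/\<partial>z\<close> of \<open>\<bar>F\<bar>\<^sup>2\<close>.\<close>

lemma line_Laplacian_sum:
  "line_Laplacian_term l w (\<alpha> + cnj \<beta>) \<gamma> + line_Laplacian_term l w (\<i> * \<alpha> + cnj (\<i> * \<beta>)) (- \<gamma>)
    = 4 * l * exp (- (l * (cmod w)\<^sup>2)) * (l * (cmod (\<alpha> * cnj w + \<beta> * w))\<^sup>2 - ((cmod \<alpha>)\<^sup>2 + (cmod \<beta>)\<^sup>2))"
  unfolding line_Laplacian_term_def cmod_power2 by (simp add: algebra_simps power2_eq_square)

lemma harmonic_line_derivatives:
  assumes S: "open S" "z \<in> S" and g: "g holomorphic_on S" and h: "h holomorphic_on S"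
  obtains e where "e > 0" 
    "\<And>v t. cmod v = 1 \<Longrightarrow> \<bar>t\<bar> < e \<Longrightarrow> ((\<lambda>t. g (z + of_real t * v) + cnj (h (z + of_real t * v)))
       has_vector_derivative (deriv g (z + of_real t * v) * v + cnj (deriv h (z + of_real t * v) * v))) (at t)"
    "\<And>v. cmod v = 1 \<Longrightarrow> ((\<lambda>t. deriv g (z + of_real t * v) * v + cnj (deriv h (z + of_real t * v) * v))
       has_vector_derivative (deriv (deriv g) z * v\<^sup>2 + cnj (deriv (deriv h) z * v\<^sup>2))) (at 0)"
proof -
  obtain e where e: "e > 0" "ball z e \<subseteq> S" using S open_contains_ball_eq by blast
  have in_S: "z + of_real t * v \<in> S" if "cmod v = 1" "\<bar>t\<bar> < e" for v t
    using e that by (auto intro!: subsetD[OF e(2)] simp: dist_norm norm_mult)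
  have line: "((\<lambda>t. p (z + of_real t * v)) has_vector_derivative deriv p (z + of_real t * v) * v) (at t)"
    if "p holomorphic_on S" "cmod v = 1" "\<bar>t\<bar> < e" for p v t
  proof -
    have "((\<lambda>t. z + of_real t * v) has_vector_derivative v) (at t)"
      by (auto intro!: derivative_eq_intros simp: has_vector_derivative_def scaleR_conv_of_real)
    from field_vector_diff_chain_at[OF this holomorphic_derivI[OF that(1) S(1) in_S[OF that(2,3)]]]
    show ?thesis by (simp add: o_def mult.commute)
  qed
  show thesis
  proof (rule that[OF e(1)])
    fix v :: complex and t :: real assume v: "cmod v = 1" "\<bar>t\<bar> < e"
    show "((\<lambda>t. g (z + of_real t * v) + cnj (h (z + of_real t * v)))
       has_vector_derivative (deriv g (z + of_real t * v) * v + cnj (deriv h (z + of_real t * v) * v))) (at t)"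
      by (intro has_vector_derivative_add has_vector_derivative_cnj line g h v)
  next
    fix v :: complex assume v: "cmod v = 1"
    have 0: "\<bar>0\<bar> < e" using e by simp
    have dg: "deriv g holomorphic_on S" "deriv h holomorphic_on S" using g h S holomorphic_deriv by blast+
    have "((\<lambda>t. deriv g (z + of_real t * v) * v) has_vector_derivative (deriv (deriv g) z * v) * v) (at 0)"
      "((\<lambda>t. deriv h (z + of_real t * v) * v) has_vector_derivative (deriv (deriv h) z * v) * v) (at 0)"
      using line[OF dg(1) v 0] line[OF dg(2) v 0] by (auto intro!: has_vector_derivative_mult_left)
    then show "((\<lambda>t. deriv g (z + of_real t * v) * v + cnj (deriv h (z + of_real t * v) * v))
       has_vector_derivative (deriv (deriv g) z * v\<^sup>2 + cnj (deriv (deriv h) z * v\<^sup>2))) (at 0)"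
      by (simp only: power2_eq_square mult.assoc[symmetric]) (intro has_vector_derivative_add has_vector_derivative_cnj)
  qed
qed

text \<open>The second summand of \<open>V\<close> has positive Laplacian where \<open>m \<bar>z\<bar>\<^sup>2 > 1\<close>, and the first is subharmonic
by assumption; a function with positive Laplacian has no local maximum.\<close>

lemma barrier_no_local_max:
  assumes S: "open S" "z \<in> S" and g: "g holomorphic_on S" and h: "h holomorphic_on S"
    and pos: "l > 0" "m > 0" "\<eta> > 0"
    and subh: "(cmod (deriv g z))\<^sup>2 + (cmod (deriv h z))\<^sup>2
       \<le> l * (cmod (deriv g z * cnj (g z + cnj (h z)) + deriv h z * (g z + cnj (h z))))\<^sup>2"
    and m: "m * (cmod z)\<^sup>2 > 1"
    and V: "\<And>w. V w = exp (- (l * (cmod (g w + cnj (h w)))\<^sup>2)) + \<eta> * exp (- (m * (cmod w)\<^sup>2))"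
    and r: "r > 0"
  shows "\<exists>w\<in>ball z r. V w > V z"
proof (rule ccontr)
  assume "\<not> ?thesis"
  then have max: "V w \<le> V z" if "dist z w < r" for w using that by (force simp: not_less)
  define F where "F = (\<lambda>w. g w + cnj (h w))"
  obtain e where e: "e > 0" 
    "\<And>v t. cmod v = 1 \<Longrightarrow> \<bar>t\<bar> < e \<Longrightarrow> ((\<lambda>t. F (z + of_real t * v))
       has_vector_derivative (deriv g (z + of_real t * v) * v + cnj (deriv h (z + of_real t * v) * v))) (at t)"
    "\<And>v. cmod v = 1 \<Longrightarrow> ((\<lambda>t. deriv g (z + of_real t * v) * v + cnj (deriv h (z + of_real t * v) * v))
       has_vector_derivative (deriv (deriv g) z * v\<^sup>2 + cnj (deriv (deriv h) z * v\<^sup>2))) (at 0)"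
    using harmonic_line_derivatives[OF S g h] unfolding F_def by blast
  have le0: "line_Laplacian_term l (F z) (deriv g z * v + cnj (deriv h z * v)) (deriv (deriv g) z * v\<^sup>2 + cnj (deriv (deriv h) z * v\<^sup>2))
      + \<eta> * line_Laplacian_term m z v 0 \<le> 0" if v: "cmod v = 1" for v
  proof -
    obtain E1 where E1: "\<And>t. \<bar>t\<bar> < e \<Longrightarrow> ((\<lambda>t. exp (- (l * (cmod (F (z + of_real t * v)))\<^sup>2))) has_real_derivative E1 t) (at t)"
      "(E1 has_real_derivative line_Laplacian_term l (F z) (deriv g z * v + cnj (deriv h z * v)) (deriv (deriv g) z * v\<^sup>2 + cnj (deriv (deriv h) z * v\<^sup>2))) (at 0)"
      using exp_neg_norm_sq_derivatives[OF e(2)[OF v] e(3)[OF v] e(1), of l] by auto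
    have "((\<lambda>t. z + of_real t * v) has_vector_derivative v) (at t)" for t
      by (auto intro!: derivative_eq_intros simp: has_vector_derivative_def scaleR_conv_of_real)
    from exp_neg_norm_sq_derivatives[OF this has_vector_derivative_const e(1), of m]
    obtain E2 where E2: "\<And>t. \<bar>t\<bar> < e \<Longrightarrow> ((\<lambda>t. exp (- (m * (cmod (z + of_real t * v))\<^sup>2))) has_real_derivative E2 t) (at t)"
      "(E2 has_real_derivative line_Laplacian_term m z v 0) (at 0)"
      by auto
    show ?thesis
    proof (rule second_derivative_test_max)
      show "min e r > 0" using e(1) r by simp
      show "((\<lambda>t. V (z + of_real t * v)) has_real_derivative E1 t + \<eta> * E2 t) (at t)" if "\<bar>t\<bar> < min e r" for t
        unfolding V using that E1(1)[of t] E2(1)[of t] unfolding F_def by (intro DERIV_add DERIV_cmult) auto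
      show "((\<lambda>t. E1 t + \<eta> * E2 t) has_real_derivative
          line_Laplacian_term l (F z) (deriv g z * v + cnj (deriv h z * v)) (deriv (deriv g) z * v\<^sup>2 + cnj (deriv (deriv h) z * v\<^sup>2))
      + \<eta> * line_Laplacian_term m z v 0) (at 0)"
        by (intro DERIV_add DERIV_cmult E1 E2)
      show "V (z + of_real t * v) \<le> V (z + of_real 0 * v)" if "\<bar>t\<bar> < min e r" for t
        using max[of "z + of_real t * v"] that v by (simp add: dist_norm norm_mult)
    qed
  qed
  define \<gamma> where "\<gamma> = deriv (deriv g) z + cnj (deriv (deriv h) z)"
  have "line_Laplacian_term l (F z) (deriv g z + cnj (deriv h z)) \<gamma> + line_Laplacian_term l (F z) (\<i> * deriv g z + cnj (\<i> * deriv h z)) (- \<gamma>)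
    + \<eta> * (line_Laplacian_term m z (1 + cnj 0) 0 + line_Laplacian_term m z (\<i> * 1 + cnj (\<i> * 0)) (- 0)) \<le> 0"
    using le0[of 1] le0[of \<i>] unfolding \<gamma>_def by (simp add: algebra_simps)
  then have "4 * l * exp (- (l * (cmod (F z))\<^sup>2)) * (l * (cmod (deriv g z * cnj (F z) + deriv h z * F z))\<^sup>2 - ((cmod (deriv g z))\<^sup>2 + (cmod (deriv h z))\<^sup>2))
     + \<eta> * (4 * m * exp (- (m * (cmod z)\<^sup>2)) * (m * (cmod z)\<^sup>2 - 1)) \<le> 0"
    unfolding line_Laplacian_sum by simp
  moreover have "0 \<le> 4 * l * exp (- (l * (cmod (F z))\<^sup>2)) * (l * (cmod (deriv g z * cnj (F z) + deriv h z * F z))\<^sup>2 - ((cmod (deriv g z))\<^sup>2 + (cmod (deriv h z))\<^sup>2))"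
    using subh pos by (intro mult_nonneg_nonneg) (auto simp: F_def)
  moreover have "0 < \<eta> * (4 * m * exp (- (m * (cmod z)\<^sup>2)) * (m * (cmod z)\<^sup>2 - 1))"
    using m pos by simp
  ultimately show False by linarith
qed

section \<open>Hopf's lemma for the distance to the boundary\<close>

lemma exp_diff_bounds:
  fixes x y :: real
  shows "0 \<le> x \<Longrightarrow> x \<le> y \<Longrightarrow> exp (- x) - exp (- y) \<le> y - x"
    and "exp (- y) * (y - x) \<le> exp (- x) - exp (- y)"
proof -
  assume xy: "0 \<le> x" "x \<le> y"
  have "exp (- x) - exp (- y) = exp (- x) * (1 - exp (x - y))"
    by (simp add: algebra_simps flip: exp_add)
  also have "\<dots> \<le> 1 * (y - x)"
  proof (rule mult_mono)
    show "1 - exp (x - y) \<le> y - x" using exp_ge_add_one_self[of "x - y"] by linarith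
  qed (use xy in auto)
  finally show "exp (- x) - exp (- y) \<le> y - x" by simp
next
  have "exp (- y) * (y - x) \<le> exp (- y) * (exp (y - x) - 1)"
  proof (rule mult_left_mono)
    show "y - x \<le> exp (y - x) - 1" using exp_ge_add_one_self[of "y - x"] by linarith
  qed simp
  also have "\<dots> = exp (- x) - exp (- y)"
    by (simp add: algebra_simps flip: exp_add)
  finally show "exp (- y) * (y - x) \<le> exp (- x) - exp (- y)" .
qed

context harmonic_homeomorphism
begin

text \<open>The maximum of the barrier over the annulus \<open>r0 \<le> \<bar>w\<bar> \<le> R\<close> is attained on its boundary. The value
of \<open>l\<close> makes the first summand subharmonic, since \<open>\<bar>f - q\<bar> \<ge> \<rho>\<close>. The value of \<open>m\<close> makes the second
strictly subharmonic down to \<open>\<bar>w\<bar> = r0\<close>. Finally, \<open>\<eta>\<close> is so small that the barrier stays below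
\<open>exp (- l \<rho>\<^sup>2)\<close> on the inner circle, where \<open>f\<close> is at distance at least \<open>\<delta>\<close> from the ball.\<close>

lemma Hopf_barrier_on_annulus:
  assumes \<rho>: "\<rho> > 0" "ball q \<rho> \<inter> \<Omega> = {}"
    and r0: "0 < r0" "r0 \<le> cmod z" "cmod z \<le> R" and R: "cball 0 R \<subseteq> D"
    and \<delta>: "\<delta> > 0" "\<And>w. cmod w = r0 \<Longrightarrow> \<rho> + \<delta> \<le> cmod (f w - q)"
    and l: "l = K\<^sup>2 / \<rho>\<^sup>2" and m: "m = 2 / r0\<^sup>2" 
    and \<eta>: "\<eta> = exp (- (l * \<rho>\<^sup>2)) - exp (- (l * (\<rho> + \<delta>)\<^sup>2))"
  shows "exp (- (l * (cmod (f z - q))\<^sup>2)) + \<eta> * exp (- (m * (cmod z)\<^sup>2))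
    \<le> exp (- (l * \<rho>\<^sup>2)) + \<eta> * exp (- (m * R\<^sup>2))"
proof -
  define G where "G = (\<lambda>w. g w - q)"
  define V where "V = (\<lambda>w. exp (- (l * (cmod (G w + cnj (h w)))\<^sup>2)) + \<eta> * exp (- (m * (cmod w)\<^sup>2)))"
  have lm: "l > 0" "m > 0" using K_ge_1 \<rho> r0 by (auto simp: l m)
  have "\<rho>\<^sup>2 < (\<rho> + \<delta>)\<^sup>2" using \<rho>(1) \<delta>(1) by (intro power_strict_mono) auto
  then have \<eta>_pos: "\<eta> > 0" using lm by (simp add: \<eta>)
  have Gf: "G w + cnj (h w) = f w - q" if "w \<in> D" for w using f_eq[OF that] by (simp add: G_def)
  have far: "\<rho> \<le> cmod (f w - q)" if "w \<in> D" for w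
    using \<rho>(2) f_in[OF that] by (force simp: dist_norm norm_minus_commute not_less)
  define A where "A = cball 0 R - ball (0::complex) r0"
  have A: "compact A" "z \<in> A" unfolding A_def using r0 by (auto intro: compact_diff)
  have G: "G holomorphic_on D" unfolding G_def using holo_g by (intro holomorphic_intros)
  have "continuous_on D V"
    unfolding V_def using holomorphic_on_imp_continuous_on[OF G] holomorphic_on_imp_continuous_on[OF holo_h]
    by (intro continuous_intros)
  then have "continuous_on A V" by (rule continuous_on_subset) (use R in \<open>auto simp: A_def\<close>)
  then obtain w where w: "w \<in> A" "\<And>w'. w' \<in> A \<Longrightarrow> V w' \<le> V w"
    using continuous_attains_sup[OF A(1)] A(2) by blast
  have wD: "w \<in> D" using w(1) R by (auto simp: A_def)
  have "\<not> (r0 < cmod w \<and> cmod w < R)"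
  proof
    assume wr: "r0 < cmod w \<and> cmod w < R"
    let ?S = "ball 0 R - cball (0::complex) r0"
    have "open ?S" by (intro open_Diff) auto
    moreover have "w \<in> ?S" using wr by simp
    ultimately obtain e where e: "e > 0" "ball w e \<subseteq> ?S" using open_contains_ball_eq by blast
    have "?S \<subseteq> A" by (auto simp: A_def)
    have "\<exists>w'\<in>ball w e. V w' > V w"
    proof (rule barrier_no_local_max[OF open_D wD G holo_h lm \<eta>_pos _ _ _ e(1)])
      have dG: "deriv G w = deriv g w"
        unfolding G_def using holomorphic_on_imp_differentiable_at[OF holo_g open_D wD] by simp
      define \<alpha> \<beta> F where "\<alpha> = deriv g w" and "\<beta> = deriv h w" and "F = G w + cnj (h w)"
      have F: "\<rho> \<le> cmod F" using far[OF wD] Gf[OF wD] by (simp add: F_def)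
      have dil: "cmod \<alpha> + cmod \<beta> \<le> K * (cmod \<alpha> - cmod \<beta>)" "cmod \<beta> \<le> cmod \<alpha>"
        using dilatation[OF wD] deriv_h_le[OF wD] by (simp_all add: \<alpha>_def \<beta>_def)
      have "(cmod \<alpha>)\<^sup>2 + (cmod \<beta>)\<^sup>2 \<le> (cmod \<alpha> + cmod \<beta>)\<^sup>2" by (simp add: power2_sum)
      also have "\<dots> \<le> (K * (cmod \<alpha> - cmod \<beta>))\<^sup>2" using dil(1) by (intro power_mono) auto
      also have "\<dots> = l * (\<rho> * (cmod \<alpha> - cmod \<beta>))\<^sup>2" using \<rho>(1) by (simp add: l power_mult_distrib)
      also have "\<dots> \<le> l * (cmod (\<alpha> * cnj F + \<beta> * F))\<^sup>2"
      proof (intro mult_left_mono power_mono)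
        have "\<rho> * (cmod \<alpha> - cmod \<beta>) \<le> cmod F * (cmod \<alpha> - cmod \<beta>)"
          using F dil(2) by (intro mult_right_mono) auto
        also have "\<dots> = cmod (\<alpha> * cnj F) - cmod (\<beta> * F)" by (simp add: norm_mult algebra_simps)
        also have "\<dots> \<le> cmod (\<alpha> * cnj F + \<beta> * F)" by (rule norm_diff_ineq)
        finally show "\<rho> * (cmod \<alpha> - cmod \<beta>) \<le> cmod (\<alpha> * cnj F + \<beta> * F)" .
      qed (use lm \<rho>(1) dil(2) in auto)
      finally show "(cmod (deriv G w))\<^sup>2 + (cmod (deriv h w))\<^sup>2
        \<le> l * (cmod (deriv G w * cnj (G w + cnj (h w)) + deriv h w * (G w + cnj (h w))))\<^sup>2"
        unfolding dG \<alpha>_def \<beta>_def F_def .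
      have "r0\<^sup>2 < (cmod w)\<^sup>2" using wr r0 by (intro power_strict_mono) auto
      then have "r0\<^sup>2 < 2 * (cmod w)\<^sup>2" using zero_le_power2[of "cmod w"] by linarith
      then show "1 < m * (cmod w)\<^sup>2" using r0(1) by (simp add: m field_simps)
    qed (simp add: V_def)
    then show False using w(2) e \<open>?S \<subseteq> A\<close> by (meson less_le_not_le subsetD)
  qed
  then consider "cmod w = r0" | "cmod w = R" using w(1) by (auto simp: A_def)
  then have "V w \<le> exp (- (l * \<rho>\<^sup>2)) + \<eta> * exp (- (m * R\<^sup>2))"
  proof cases
    case 1
    have "(\<rho> + \<delta>)\<^sup>2 \<le> (cmod (f w - q))\<^sup>2" using \<delta> \<rho>(1) 1 by (intro power_mono) auto
    then have "exp (- (l * (cmod (f w - q))\<^sup>2)) \<le> exp (- (l * (\<rho> + \<delta>)\<^sup>2))" using lm by simp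
    moreover have "\<eta> * exp (- (m * (cmod w)\<^sup>2)) \<le> \<eta> * 1" using lm \<eta>_pos by (intro mult_left_mono) auto
    ultimately have "V w \<le> exp (- (l * \<rho>\<^sup>2))" unfolding V_def Gf[OF wD] using \<eta> by linarith
    then show ?thesis using \<eta>_pos by (meson add_increasing2 exp_ge_zero less_imp_le mult_nonneg_nonneg)
  next
    case 2
    have "\<rho>\<^sup>2 \<le> (cmod (f w - q))\<^sup>2" using far[OF wD] \<rho>(1) by (intro power_mono) auto
    then show ?thesis unfolding V_def Gf[OF wD] 2 using lm by simp
  qed
  moreover have "z \<in> D" using r0 R by auto
  moreover have "V z = exp (- (l * (cmod (f z - q))\<^sup>2)) + \<eta> * exp (- (m * (cmod z)\<^sup>2))"
    unfolding V_def Gf[OF \<open>z \<in> D\<close>] ..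
  ultimately show ?thesis using w(2)[OF A(2)] by linarith
qed

text \<open>The barrier estimate in the limit \<open>R \<rightarrow> 1\<close>, turned into a linear lower bound of the distance \<open>d\<close>.\<close>

lemma dist_exterior_ball_ge:
  assumes disc: "D = ball 0 1"
    and \<rho>: "\<rho> > 0" "ball q \<rho> \<inter> \<Omega> = {}"
    and r0: "0 < r0" "r0 \<le> cmod z" and z: "z \<in> D"
    and \<delta>: "\<delta> > 0" "\<And>w. cmod w = r0 \<Longrightarrow> \<rho> + \<delta> \<le> cmod (f w - q)"
    and l: "l = K\<^sup>2 / \<rho>\<^sup>2" and m: "m = 2 / r0\<^sup>2" 
    and \<eta>: "\<eta> = exp (- (l * \<rho>\<^sup>2)) - exp (- (l * (\<rho> + \<delta>)\<^sup>2))"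
    and d: "cmod (f z - q) \<le> \<rho> + d" "0 \<le> d" "d \<le> M"
  shows "\<eta> * (exp (- m) * m) / (l * (2 * \<rho> + M)) * (1 - cmod z) \<le> d"
proof -
  have z1: "cmod z < 1" using z disc by simp
  have lm: "l > 0" "m > 0" using K_ge_1 \<rho> r0 by (auto simp: l m)
  have "\<rho>\<^sup>2 < (\<rho> + \<delta>)\<^sup>2" using \<rho>(1) \<delta>(1) by (intro power_strict_mono) auto
  then have \<eta>_pos: "\<eta> > 0" using lm by (simp add: \<eta>)
  let ?L = "exp (- (l * (cmod (f z - q))\<^sup>2)) + \<eta> * exp (- (m * (cmod z)\<^sup>2))"
  have "?L \<le> exp (- (l * \<rho>\<^sup>2)) + \<eta> * exp (- (m * 1\<^sup>2))"
  proof (rule tendsto_lowerbound[where F = "at_left 1" and f = "\<lambda>R. exp (- (l * \<rho>\<^sup>2)) + \<eta> * exp (- (m * R\<^sup>2))"])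
    show "((\<lambda>R. exp (- (l * \<rho>\<^sup>2)) + \<eta> * exp (- (m * R\<^sup>2))) \<longlongrightarrow> exp (- (l * \<rho>\<^sup>2)) + \<eta> * exp (- (m * 1\<^sup>2))) (at_left 1)"
      by (intro tendsto_intros)
    have "\<forall>\<^sub>F R in at_left 1. R \<in> {cmod z<..<1}" by (rule eventually_at_left_real[OF z1])
    then show "\<forall>\<^sub>F R in at_left 1. ?L \<le> exp (- (l * \<rho>\<^sup>2)) + \<eta> * exp (- (m * R\<^sup>2))"
    proof (rule eventually_mono)
      fix R assume "R \<in> {cmod z<..<1}"
      then have R: "cmod z \<le> R" "cball 0 R \<subseteq> D" by (auto simp: disc)
      show "?L \<le> exp (- (l * \<rho>\<^sup>2)) + \<eta> * exp (- (m * R\<^sup>2))"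
        by (rule Hopf_barrier_on_annulus[OF \<rho> r0 R \<delta> l m \<eta>])
    qed
  qed simp
  then have "?L \<le> exp (- (l * \<rho>\<^sup>2)) + \<eta> * exp (- m)" by simp
  moreover have "exp (- (l * (\<rho> + d)\<^sup>2)) \<le> exp (- (l * (cmod (f z - q))\<^sup>2))"
    using d lm power_mono[OF d(1), of 2] by simp
  ultimately have "\<eta> * (exp (- (m * (cmod z)\<^sup>2)) - exp (- m)) \<le> exp (- (l * \<rho>\<^sup>2)) - exp (- (l * (\<rho> + d)\<^sup>2))"
    unfolding right_diff_distrib by linarith
  also have "\<dots> \<le> l * (\<rho> + d)\<^sup>2 - l * \<rho>\<^sup>2"
    using lm \<rho>(1) d by (intro exp_diff_bounds) (auto intro!: power_mono)
  also have "\<dots> = d * (l * (2 * \<rho> + d))" by (simp add: power2_eq_square algebra_simps)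
  also have "\<dots> \<le> d * (l * (2 * \<rho> + M))" using d lm by (intro mult_left_mono) auto
  finally have up: "\<eta> * (exp (- (m * (cmod z)\<^sup>2)) - exp (- m)) \<le> d * (l * (2 * \<rho> + M))" .
  have "(cmod z)\<^sup>2 \<le> cmod z" using z1 by (simp add: power2_eq_square mult_left_le)
  then have "exp (- m) * m * (1 - cmod z) \<le> exp (- m) * m * (1 - (cmod z)\<^sup>2)"
    using lm by (intro mult_left_mono) auto
  also have "\<dots> = exp (- m) * (m - m * (cmod z)\<^sup>2)" by (simp add: algebra_simps)
  also have "\<dots> \<le> exp (- (m * (cmod z)\<^sup>2)) - exp (- m)" by (rule exp_diff_bounds)
  finally have "\<eta> * (exp (- m) * m * (1 - cmod z)) \<le> d * (l * (2 * \<rho> + M))"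
    using up \<eta>_pos by (meson mult_left_mono less_imp_le order_trans)
  moreover have "l * (2 * \<rho> + M) > 0" using lm \<rho>(1) d by simp
  ultimately show ?thesis by (simp add: field_simps)
qed

end

text \<open>A bound of \<open>Re P\<close> bounds \<open>exp P\<close> from above and below, and Cauchy's inequality for \<open>exp P\<close> on a
disk of radius \<open>1 / 4\<close> bounds its derivative \<open>P' exp P\<close>.\<close>

lemma bounded_Re_holomorphic_deriv_le:
  assumes P: "P holomorphic_on ball 0 1" and M: "\<And>z. cmod z < 1 \<Longrightarrow> \<bar>Re (P z)\<bar> \<le> M"
    and z: "cmod z \<le> 1 / 2"
  shows "cmod (deriv P z) \<le> 4 * exp (2 * M)"
proof -
  define Q where "Q = (\<lambda>w. exp (P w))"
  have Q: "Q holomorphic_on ball 0 1" unfolding Q_def using P by (intro holomorphic_intros)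
  have sub: "cball z (1/4) \<subseteq> ball 0 1"
  proof
    fix w assume "w \<in> cball z (1/4)"
    then have "cmod (w - z) \<le> 1/4" by (simp add: dist_norm norm_minus_commute)
    then have "cmod w < 1" using norm_triangle_sub[of w z] z by simp
    then show "w \<in> ball 0 1" by simp
  qed
  have "cmod ((deriv ^^ 1) Q z) \<le> fact 1 * exp M / (1/4) ^ 1"
  proof (rule Cauchy_inequality)
    show "Q holomorphic_on ball z (1/4)" 
      using Q by (rule holomorphic_on_subset) (use sub ball_subset_cball in blast)
    show "continuous_on (cball z (1/4)) Q"
      using holomorphic_on_imp_continuous_on[OF Q] sub by (rule continuous_on_subset)
    fix x assume "cmod (z - x) = 1/4"
    then have "cmod x < 1" using subsetD[OF sub, of x] by (simp add: dist_norm)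
    then show "cmod (Q x) \<le> exp M" using M[of x] by (simp add: Q_def)
  qed simp
  then have 1: "cmod (deriv Q z) \<le> 4 * exp M" by simp
  have z1: "cmod z < 1" using z by simp
  have "(P has_field_derivative deriv P z) (at z)" using P z1 by (intro holomorphic_derivI) auto
  then have "(Q has_field_derivative exp (P z) * deriv P z) (at z)"
    unfolding Q_def by (auto intro!: derivative_eq_intros)
  then have "deriv Q z = exp (P z) * deriv P z" by (rule DERIV_imp_deriv)
  with 1 have "exp (Re (P z)) * cmod (deriv P z) \<le> 4 * exp M" by (simp add: norm_mult)
  moreover have "exp (- M) * cmod (deriv P z) \<le> exp (Re (P z)) * cmod (deriv P z)"
    using M[OF z1] by (intro mult_right_mono) auto
  ultimately have "exp M * (exp (- M) * cmod (deriv P z)) \<le> exp M * (4 * exp M)"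
    by (intro mult_left_mono) auto
  moreover have "exp M * (exp (- M) * x) = x" "exp M * (4 * exp M) = 4 * exp (2 * M)" for x
    by (simp_all flip: exp_add mult.assoc)
  ultimately show ?thesis by simp
qed

lemma bounded_Re_holomorphic_Lipschitz_at_0:
  assumes P: "P holomorphic_on ball 0 1" and M: "\<And>z. cmod z < 1 \<Longrightarrow> \<bar>Re (P z)\<bar> \<le> M"
    and z: "cmod z \<le> 1 / 2"
  shows "\<bar>Re (P z) - Re (P 0)\<bar> \<le> 4 * exp (2 * M) * cmod z"
proof -
  have "cmod (P z - P 0) \<le> 4 * exp (2 * M) * cmod (z - 0)"
  proof (rule field_differentiable_bound[where S = "cball 0 (1/2)" and f = P and f' = "deriv P"])
    show "(P has_field_derivative deriv P w) (at w within cball 0 (1/2))" if "w \<in> cball 0 (1/2)" for w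
      by (rule has_field_derivative_at_within, rule holomorphic_derivI[OF P open_ball]) (use that in auto)
    show "cmod (deriv P w) \<le> 4 * exp (2 * M)" if "w \<in> cball 0 (1/2)" for w
      by (rule bounded_Re_holomorphic_deriv_le[OF P M]) (use that in auto)
  qed (use z in auto)
  then show ?thesis using abs_Re_le_cmod[of "P z - P 0"] by simp
qed

text \<open>Makes the maps of the theorem equicontinuous at \<open>0\<close>: real and imaginary part of \<open>g + cnj h\<close> are the real
parts of the holomorphic functions \<open>g + h\<close> and \<open>- \<i> (g - h)\<close>.\<close>

lemma bounded_harmonic_Lipschitz_at_0:
  assumes g: "g holomorphic_on ball 0 1" and h: "h holomorphic_on ball 0 1"
    and M: "\<And>z. cmod z < 1 \<Longrightarrow> cmod (g z + cnj (h z)) \<le> M"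
    and z: "cmod z \<le> 1 / 2"
  shows "cmod ((g z + cnj (h z)) - (g 0 + cnj (h 0))) \<le> 8 * exp (2 * M) * cmod z"
proof -
  let ?F = "\<lambda>z. g z + cnj (h z)"
  have "\<bar>Re (g z + h z) - Re (g 0 + h 0)\<bar> \<le> 4 * exp (2 * M) * cmod z"
  proof (rule bounded_Re_holomorphic_Lipschitz_at_0[where P = "\<lambda>z. g z + h z", OF _ _ z])
    show "(\<lambda>z. g z + h z) holomorphic_on ball 0 1" using g h by (intro holomorphic_intros)
    show "\<bar>Re (g z + h z)\<bar> \<le> M" if "cmod z < 1" for z
      using M[OF that] abs_Re_le_cmod[of "?F z"] by simp
  qed
  moreover have "\<bar>Re (- \<i> * (g z - h z)) - Re (- \<i> * (g 0 - h 0))\<bar> \<le> 4 * exp (2 * M) * cmod z"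
  proof (rule bounded_Re_holomorphic_Lipschitz_at_0[where P = "\<lambda>z. - \<i> * (g z - h z)", OF _ _ z])
    show "(\<lambda>z. - \<i> * (g z - h z)) holomorphic_on ball 0 1" using g h by (intro holomorphic_intros)
    show "\<bar>Re (- \<i> * (g z - h z))\<bar> \<le> M" if "cmod z < 1" for z
      using M[OF that] abs_Im_le_cmod[of "?F z"] by simp
  qed
  ultimately show ?thesis using cmod_le[of "?F z - ?F 0"] by simp
qed

section \<open>Curves of class \<open>C\<^sup>1\<^sup>,\<^sup>1\<close> and tangent balls\<close>

lemma arc_length_parametrization_Lipschitz:
  assumes "arc_length_parametrization \<Gamma> l g"
  shows "cmod (g t - g s) \<le> \<bar>t - s\<bar>"
proof -
  have *: "cmod (g t - g s) \<le> t - s" if "s \<le> t" for s t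
  proof -
    have "ennreal (\<Sum>i<length [s, t] - 1. cmod (g ([s, t] ! Suc i) - g ([s, t] ! i))) \<le> curve_length g s t"
      unfolding curve_length_def by (rule SUP_upper) (use that in auto)
    also have "\<dots> = ennreal (t - s)" using assms that by (simp add: arc_length_parametrization_def)
    finally show ?thesis using that by simp
  qed
  show ?thesis
    using *[of s t] *[of t s] by (cases "s \<le> t") (auto simp: norm_minus_commute)
qed

text \<open>Used with \<open>c < 1\<close>: a parametrization of speed less than one is shorter than its parameter interval, so
that an arc-length parametrization has unit speed.\<close>

lemma curve_length_le:
  assumes lip: "\<And>x y. a \<le> x \<Longrightarrow> x \<le> y \<Longrightarrow> y \<le> b \<Longrightarrow> cmod (g y - g x) \<le> c * (y - x)"
    and "0 \<le> c" "a \<le> b"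
  shows "curve_length g a b \<le> ennreal (c * (b - a))"
  unfolding curve_length_def
proof (rule SUP_least, clarify, rule ennreal_leI)
  fix ts :: "real list" assume ts: "sorted ts" "set ts \<subseteq> {a..b}"
  show "(\<Sum>i<length ts - 1. cmod (g (ts ! Suc i) - g (ts ! i))) \<le> c * (b - a)"
  proof (cases "ts = []")
    case False
    then have len: "length ts - 1 < length ts" "0 < length ts" by auto
    have "(\<Sum>i<length ts - 1. cmod (g (ts ! Suc i) - g (ts ! i))) \<le> (\<Sum>i<length ts - 1. c * (ts ! Suc i - ts ! i))"
    proof (rule sum_mono)
      fix i assume "i \<in> {..<length ts - 1}"
      then have i: "Suc i < length ts" "i < length ts" by auto
      have "ts ! i \<le> ts ! Suc i" using ts(1) i by (simp add: sorted_nth_mono)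
      moreover have "ts ! i \<in> {a..b}" "ts ! Suc i \<in> {a..b}" using ts(2) i nth_mem by blast+
      ultimately show "cmod (g (ts ! Suc i) - g (ts ! i)) \<le> c * (ts ! Suc i - ts ! i)"
        by (intro lip) auto
    qed
    also have "\<dots> = c * (ts ! (length ts - 1) - ts ! 0)"
      unfolding sum_distrib_left[symmetric] by (subst sum_lessThan_telescope) simp
    also have "\<dots> \<le> c * (b - a)"
    proof (intro mult_left_mono diff_mono)
      show "ts ! (length ts - 1) \<le> b" "a \<le> ts ! 0"
        using ts(2) nth_mem[OF len(1)] nth_mem[OF len(2)] by auto
    qed (use assms in auto)
    finally show ?thesis .
  qed (use assms in auto)
qed

lemma chord_tangent:
  fixes g :: "real \<Rightarrow> complex"
  assumes g: "\<And>t. (g has_vector_derivative T t) (at t)" and T: "\<And>s t. cmod (T t - T s) \<le> L * \<bar>t - s\<bar>"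
    and "L > 0"
  shows "cmod (g s - g t - of_real (s - t) * T t) \<le> L * (s - t)\<^sup>2"
proof -
  have "norm (g s - g t - (s - t) *\<^sub>R T t) \<le> norm (s - t) * (L * \<bar>s - t\<bar>)"
  proof (rule vector_differentiable_bound_linearization[where S = "closed_segment t s"])
    show "(g has_vector_derivative T x) (at x within closed_segment t s)" for x
      using g by (rule has_vector_derivative_at_within)
    show "norm (T x - T t) \<le> L * \<bar>s - t\<bar>" if "x \<in> closed_segment t s" for x
    proof -
      have "\<bar>x - t\<bar> \<le> \<bar>s - t\<bar>" using that by (auto simp: closed_segment_eq_real_ivl split: if_splits)
      then show ?thesis using T[of x t] \<open>L > 0\<close> mult_left_mono[of "\<bar>x - t\<bar>" "\<bar>s - t\<bar>" L] by linarith
    qed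
  qed auto
  also have "norm (s - t) * (L * \<bar>s - t\<bar>) = L * (s - t)\<^sup>2"
    by (simp add: power2_eq_square flip: abs_mult)
  finally show ?thesis by (simp only: scaleR_conv_of_real)
qed

locale closed_unit_speed_curve =
  fixes \<Gamma> :: "complex set" and l :: real and g T :: "real \<Rightarrow> complex" and L :: real
  assumes l_pos: "l > 0" and periodic: "\<And>t. g (t + l) = g t" and inj: "inj_on g {0..<l}"
    and image: "g ` {0..<l} = \<Gamma>" and g_deriv: "\<And>t. (g has_vector_derivative T t) (at t)"
    and T_unit: "\<And>t. cmod (T t) = 1" and T_lip: "\<And>s t. cmod (T t - T s) \<le> L * \<bar>t - s\<bar>"
    and L_pos: "L > 0"

lemma Jordan_curve_of_class_1_1_imp_closed_unit_speed_curve: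
  assumes "Jordan_curve_of_class 1 1 \<Gamma>"
  obtains l g T L where "closed_unit_speed_curve \<Gamma> l g T L"
proof -
  obtain l g where arc: "arc_length_parametrization \<Gamma> l g" and C: "C_k 1 g"
    and bdd: "bdd_above {cmod (higher_vderiv 1 g t - higher_vderiv 1 g s) / \<bar>t - s\<bar> powr 1 | s t. s \<noteq> t}"
    using assms unfolding Jordan_curve_of_class_def by blast
  define T where "T = (\<lambda>t. vector_derivative g (at t))"
  have T: "higher_vderiv 1 g = T" "higher_vderiv 0 g = g" by (simp_all add: higher_vderiv_def T_def)
  have "g differentiable (at t)" for t
    using C T(2) unfolding C_k_def by (auto simp: differentiable_on_def)
  then have der: "(g has_vector_derivative T t) (at t)" for t
    unfolding T_def by (simp add: vector_derivative_works)
  obtain B where B: "\<And>x. x \<in> {cmod (T t - T s) / \<bar>t - s\<bar> powr 1 | s t. s \<noteq> t} \<Longrightarrow> x \<le> B"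
    using bdd unfolding T bdd_above_def by blast
  define L where "L = max B 1"
  have lip: "cmod (T t - T s) \<le> L * \<bar>t - s\<bar>" for s t
  proof (cases "s = t")
    case False
    then have "cmod (T t - T s) / \<bar>t - s\<bar> powr 1 \<le> L" using B unfolding L_def by fastforce
    then show ?thesis using False by (simp add: field_simps)
  qed simp
  have le1: "cmod (T t) \<le> 1" for t
  proof (rule field_le_epsilon)
    fix e :: real assume "0 < e"
    have L: "L > 0" by (simp add: L_def)
    define d where "d = e / L"
    have d: "d > 0" using \<open>0 < e\<close> L by (simp add: d_def)
    have "d * cmod (T t) = cmod (of_real (t + d - t) * T t)" using d by (simp add: norm_mult)
    also have "\<dots> \<le> cmod (g (t + d) - g t) + cmod (g (t + d) - g t - of_real (t + d - t) * T t)"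
      by (metis norm_minus_commute norm_triangle_sub)
    also have "\<dots> \<le> d + L * d\<^sup>2"
      using arc_length_parametrization_Lipschitz[OF arc, of "t + d" t] chord_tangent[OF der lip L, of "t + d" t] d by simp
    also have "\<dots> = d * (1 + e)" using L by (simp add: d_def power2_eq_square field_simps)
    finally show "cmod (T t) \<le> 1 + e" using d by simp
  qed
  have ge1: "1 \<le> cmod (T t)" for t
  proof (rule ccontr)
    assume "\<not> 1 \<le> cmod (T t)"
    then have lt: "cmod (T t) < 1" by simp
    define c where "c = (cmod (T t) + 1) / 2"
    have c: "cmod (T t) < c" "c < 1" "0 \<le> c" using lt by (auto simp: c_def)
    \<comment> \<open>By the Lipschitz condition, \<open>\<bar>T\<bar> \<le> c < 1\<close> on the interval of length \<open>e\<close> to the right of \<open>t\<close>.\<close>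
    define e where "e = (c - cmod (T t)) / L"
    have L: "L > 0" by (simp add: L_def)
    have e: "e > 0" using c L by (simp add: e_def)
    have Tc: "cmod (T s) \<le> c" if "t \<le> s" "s \<le> t + e" for s
    proof -
      have "cmod (T s) \<le> cmod (T t) + cmod (T s - T t)" by (rule norm_triangle_sub)
      also have "\<dots> \<le> cmod (T t) + L * e"
      proof -
        have "L * \<bar>s - t\<bar> \<le> L * e" using that L by (intro mult_left_mono) auto
        then show ?thesis using lip[of s t] by linarith
      qed
      also have "\<dots> = c" using L by (simp add: e_def)
      finally show ?thesis .
    qed
    have "curve_length g t (t + e) \<le> ennreal (c * (t + e - t))"
    proof (rule curve_length_le)
      fix x y assume xy: "t \<le> x" "x \<le> y" "y \<le> t + e"
      have "norm (g y - g x) \<le> c * norm (y - x)"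
      proof (rule differentiable_bound[where S = "{x..y}" and f' = "\<lambda>s h. h *\<^sub>R T s"])
        show "(g has_derivative (\<lambda>h. h *\<^sub>R T s)) (at s within {x..y})" for s
          using der[of s] unfolding has_vector_derivative_def by (rule has_derivative_at_withinI)
        show "onorm (\<lambda>h. h *\<^sub>R T s) \<le> c" if "s \<in> {x..y}" for s
        proof (rule onorm_le)
          have "cmod (T s) \<le> c" using Tc[of s] that xy by simp
          then show "norm (h *\<^sub>R T s) \<le> c * norm h" for h
            using mult_right_mono[of "cmod (T s)" c "\<bar>h\<bar>"] by (simp add: mult.commute)
        qed
      qed (use xy in auto)
      then show "cmod (g y - g x) \<le> c * (y - x)" using xy by simp
    qed (use c e in auto)
    moreover have "curve_length g t (t + e) = ennreal e"
      using arc e by (simp add: arc_length_parametrization_def)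
    ultimately have "ennreal e \<le> ennreal (c * e)" by simp
    then have "e \<le> c * e" using c e by (simp add: ennreal_le_iff)
    then show False using c e by simp
  qed
  show thesis
  proof (rule that, unfold_locales)
    show "l > 0" "\<And>t. g (t + l) = g t" "inj_on g {0..<l}" "g ` {0..<l} = \<Gamma>"
      using arc by (auto simp: arc_length_parametrization_def)
    show "cmod (T t) = 1" for t using le1[of t] ge1[of t] by simp
  qed (use der lip in \<open>auto simp: L_def\<close>)
qed

context closed_unit_speed_curve
begin

lemma g_in: "g t \<in> \<Gamma>"
proof -
  interpret periodic_fun_simple g l by unfold_locales (rule periodic)
  define s where "s = t - of_int \<lfloor>t / l\<rfloor> * l"
  have "s \<in> {0..<l}"
    unfolding s_def using l_pos floor_divide_lower[OF l_pos, of t] floor_divide_upper[OF l_pos, of t]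
    by (auto simp: algebra_simps)
  moreover have "g t = g s" unfolding s_def by (simp add: minus_of_int)
  ultimately show ?thesis using image by auto
qed

lemma obtain_parameter:
  assumes "p \<in> \<Gamma>" obtains t where "0 \<le> t" "t < l" "p = g t"
proof -
  have "p \<in> g ` {0..<l}" using assms by (simp only: image)
  then show thesis using that by auto
qed

text \<open>Points whose parameters are not close modulo the period are uniformly far apart, by compactness and
injectivity.\<close>

lemma chord_ge:
  assumes "0 < \<delta>"
  obtains m where "m > 0" "\<And>t r. \<lbrakk>0 \<le> t; t \<le> l; \<delta> \<le> r; r \<le> l - \<delta>\<rbrakk> \<Longrightarrow> m \<le> cmod (g (t + r) - g t)"
proof (cases "\<delta> \<le> l - \<delta>")
  case True
  let ?S = "{0..l} \<times> {\<delta>..l - \<delta>}"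
  have cg: "continuous_on UNIV g"
    using g_deriv has_vector_derivative_continuous by (blast intro: continuous_at_imp_continuous_on)
  have "continuous_on ?S (\<lambda>x. cmod (g (fst x + snd x) - g (fst x)))"
    by (intro continuous_intros continuous_on_compose2[OF cg]) auto
  moreover have "compact ?S" "?S \<noteq> {}" using True l_pos by (auto intro: compact_Times)
  ultimately obtain x where x: "x \<in> ?S" "\<And>y. y \<in> ?S \<Longrightarrow> cmod (g (fst x + snd x) - g (fst x)) \<le> cmod (g (fst y + snd y) - g (fst y))"
    using continuous_attains_inf[of ?S] by blast
  show thesis
  proof (rule that)
    obtain t r where tr: "x = (t, r)" "0 \<le> t" "t \<le> l" "\<delta> \<le> r" "r \<le> l - \<delta>" using x(1) by auto
    have "g (t + r) \<noteq> g t"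
    proof
      assume eq: "g (t + r) = g t"
      \<comment> \<open>Reduce both parameters to \<open>{0..<l}\<close>, where \<open>g\<close> is injective.\<close>
      define t' where "t' = (if t = l then 0 else t)"
      define r' where "r' = (if t' + r < l then t' + r else t' + r - l)"
      have "g t' = g t" "g (t' + r) = g (t + r)"
        using periodic[of 0] periodic[of r] by (auto simp: t'_def add.commute)
      moreover have "g r' = g (t' + r)" using periodic[of "t' + r - l"] by (simp add: r'_def)
      moreover have "t' \<in> {0..<l}" "r' \<in> {0..<l}" "r' \<noteq> t'"
        using tr assms l_pos by (auto simp: t'_def r'_def)
      ultimately show False using inj eq unfolding inj_on_def by metis
    qed
    then show "0 < cmod (g (fst x + snd x) - g (fst x))" by (simp add: tr)
    show "cmod (g (fst x + snd x) - g (fst x)) \<le> cmod (g (t + r) - g t)"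
      if "0 \<le> t" "t \<le> l" "\<delta> \<le> r" "r \<le> l - \<delta>" for t r
      using x(2)[of "(t, r)"] that by simp
  qed
next
  case False
  then show thesis by (intro that[of 1]) auto
qed

text \<open>The center of the ball of radius \<open>\<bar>\<rho>\<bar>\<close> that touches the curve at \<open>g t\<close>; the sign of \<open>\<rho>\<close> selects the
side.\<close>

definition center :: "real \<Rightarrow> real \<Rightarrow> complex" where
  "center \<rho> t = g t + of_real \<rho> * (\<i> * T t)"

text \<open>In the orthonormal frame at \<open>g t\<close> with first vector \<open>T t\<close>, the point \<open>g s\<close> has coordinates
\<open>\<tau> + O(L \<tau>\<^sup>2)\<close> and \<open>O(L \<tau>\<^sup>2)\<close>. It lies outside the ball if twice the product of \<open>\<rho>\<close> and the second
coordinate is at most the square of the first.\<close>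

lemma near_chord_avoids_ball:
  assumes r: "\<bar>s - t\<bar> * (2 * L) \<le> 1" and \<rho>: "8 * L * \<bar>\<rho>\<bar> \<le> 1"
  shows "\<bar>\<rho>\<bar> \<le> cmod (g s - center \<rho> t)"
proof -
  define \<tau> v where "\<tau> = s - t" and "v = (g s - g t) * cnj (T t)"
  have TT: "T t * cnj (T t) = 1" using complex_norm_square[of "T t"] T_unit[of t] by simp
  have "v - of_real \<tau> = (g s - g t - of_real \<tau> * T t) * cnj (T t)"
    using TT by (simp add: v_def algebra_simps)
  then have "cmod (v - of_real \<tau>) \<le> L * \<tau>\<^sup>2"
    using chord_tangent[OF g_deriv T_lip L_pos, of s t] T_unit[of t] by (simp add: norm_mult \<tau>_def)
  then have re: "\<bar>Re v - \<tau>\<bar> \<le> L * \<tau>\<^sup>2" and im: "\<bar>Im v\<bar> \<le> L * \<tau>\<^sup>2"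
    using abs_Re_le_cmod[of "v - of_real \<tau>"] abs_Im_le_cmod[of "v - of_real \<tau>"] by auto
  have "L * \<tau>\<^sup>2 = (\<bar>\<tau>\<bar> * (2 * L)) * (\<bar>\<tau>\<bar> / 2)"
    by (simp add: power2_eq_square flip: abs_mult)
  also have "\<dots> \<le> 1 * (\<bar>\<tau>\<bar> / 2)" using r by (intro mult_right_mono) (auto simp: \<tau>_def)
  finally have "\<bar>\<tau>\<bar> / 2 \<le> \<bar>Re v\<bar>" using re by linarith
  then have "(\<bar>\<tau>\<bar> / 2)\<^sup>2 \<le> \<bar>Re v\<bar>\<^sup>2" by (intro power_mono) auto
  then have A: "\<tau>\<^sup>2 / 4 \<le> (Re v)\<^sup>2" by (simp add: power_divide)
  have "2 * (\<rho> * Im v) \<le> 2 * (\<bar>\<rho>\<bar> * (L * \<tau>\<^sup>2))"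
    using im abs_mult[of \<rho> "Im v"] mult_left_mono[OF im, of "\<bar>\<rho>\<bar>"] by linarith
  also have "\<dots> = (8 * L * \<bar>\<rho>\<bar>) * (\<tau>\<^sup>2 / 4)" by simp
  also have "\<dots> \<le> 1 * (\<tau>\<^sup>2 / 4)" using \<rho> by (intro mult_right_mono) auto
  finally have "2 * (\<rho> * Im v) \<le> (Re v)\<^sup>2" using A by simp
  moreover have "(Im v - \<rho>)\<^sup>2 = (Im v)\<^sup>2 - 2 * (\<rho> * Im v) + \<rho>\<^sup>2" by (simp add: power2_diff)
  ultimately have "\<rho>\<^sup>2 \<le> (Re v)\<^sup>2 + (Im v - \<rho>)\<^sup>2" using zero_le_power2[of "Im v"] by linarith
  also have "\<dots> = (cmod (v - of_real \<rho> * \<i>))\<^sup>2" by (simp add: cmod_power2)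
  also have "v - of_real \<rho> * \<i> = (g s - center \<rho> t) * cnj (T t)"
    using TT by (simp add: v_def center_def algebra_simps)
  also have "cmod \<dots> = cmod (g s - center \<rho> t)" by (simp add: norm_mult T_unit)
  finally show ?thesis using abs_le_square_iff[of \<rho> "cmod (g s - center \<rho> t)"] by simp
qed

text \<open>Both tangent balls avoid the whole curve: nearby points by \<open>near_chord_avoids_ball\<close>, the others because
they are too far from the point of tangency.\<close>

lemma obtain_ball_radius:
  obtains \<rho> where "\<rho> > 0" 
    "\<And>t x \<sigma>. 0 \<le> t \<Longrightarrow> t < l \<Longrightarrow> x \<in> \<Gamma> \<Longrightarrow> \<bar>\<sigma>\<bar> = \<rho> \<Longrightarrow> \<rho> \<le> cmod (x - center \<sigma> t)"
proof -
  define \<delta> where "\<delta> = 1 / (2 * L)"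
  have \<delta>: "\<delta> > 0" using L_pos by (simp add: \<delta>_def)
  obtain m where m: "m > 0" "\<And>t r. \<lbrakk>0 \<le> t; t \<le> l; \<delta> \<le> r; r \<le> l - \<delta>\<rbrakk> \<Longrightarrow> m \<le> cmod (g (t + r) - g t)"
    using chord_ge[OF \<delta>] by blast
  define \<rho> where "\<rho> = min (1 / (8 * L)) (m / 2)"
  have \<rho>: "\<rho> > 0" "8 * L * \<rho> \<le> 1" "2 * \<rho> \<le> m"
    using L_pos m(1) by (auto simp: \<rho>_def min_def field_simps)
  show thesis
  proof (rule that[OF \<rho>(1)])
    fix t x \<sigma> assume t: "0 \<le> t" "t < l" and x: "x \<in> \<Gamma>" and \<sigma>: "\<bar>\<sigma>\<bar> = \<rho>"
    have \<sigma>L: "8 * L * \<bar>\<sigma>\<bar> \<le> 1" using \<sigma> \<rho> by simp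
    obtain s' where s': "0 \<le> s'" "s' < l" "x = g s'" using obtain_parameter[OF x] .
    define r where "r = (if t \<le> s' then s' - t else s' - t + l)"
    have r: "0 \<le> r" "r < l" "x = g (t + r)" 
      using s' t periodic[of s'] by (auto simp: r_def algebra_simps)
    consider "r \<le> \<delta>" | "l - r \<le> \<delta>" | "\<delta> \<le> r" "r \<le> l - \<delta>" by linarith
    then show "\<rho> \<le> cmod (x - center \<sigma> t)"
    proof cases
      case 1
      have "\<bar>(t + r) - t\<bar> * (2 * L) \<le> 1" using 1 r L_pos by (simp add: \<delta>_def field_simps)
      from near_chord_avoids_ball[OF this \<sigma>L] show ?thesis using r \<sigma> by simp
    next
      case 2
      have "\<bar>(t + r - l) - t\<bar> * (2 * L) \<le> 1" using 2 r L_pos by (simp add: \<delta>_def field_simps)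
      from near_chord_avoids_ball[OF this \<sigma>L] show ?thesis using r \<sigma> periodic[of "t + r - l"] by simp
    next
      case 3
      have "2 * \<rho> \<le> cmod (x - g t)" using m(2)[of t r] 3 t r \<rho>(3) by simp
      also have "x - g t = (x - center \<sigma> t) + of_real \<sigma> * (\<i> * T t)" by (simp add: center_def)
      also have "cmod \<dots> \<le> cmod (x - center \<sigma> t) + cmod (of_real \<sigma> * (\<i> * T t))" by (rule norm_triangle_ineq)
      also have "cmod (of_real \<sigma> * (\<i> * T t)) = \<rho>" using \<sigma> by (simp add: norm_mult T_unit)
      finally show ?thesis by simp
    qed
  qed
qed

text \<open>The squared distance to \<open>w\<close> has a critical point at the parameter of the nearest point.\<close>

lemma nearest_point_normal:
  assumes near: "\<And>x. x \<in> \<Gamma> \<Longrightarrow> cmod (w - g t) \<le> cmod (w - x)"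
  obtains y where "w = g t + of_real y * (\<i> * T t)" "\<bar>y\<bar> = cmod (w - g t)"
proof -
  define v where "v = (w - g t) * cnj (T t)"
  have TT: "T t * cnj (T t) = 1" using complex_norm_square[of "T t"] T_unit[of t] by simp
  have "((\<lambda>s. (g s - w) \<bullet> (g s - w)) has_derivative (\<lambda>h. (g t - w) \<bullet> (h *\<^sub>R T t) + (h *\<^sub>R T t) \<bullet> (g t - w))) (at t)"
    using g_deriv[of t] unfolding has_vector_derivative_def by (auto intro!: derivative_eq_intros)
  then have "((\<lambda>s. - ((g s - w) \<bullet> (g s - w))) has_real_derivative - (2 * ((g t - w) \<bullet> T t))) (at t)"
    unfolding has_field_derivative_def
    by (rule has_derivative_eq_rhs[OF has_derivative_minus]) (auto simp: inner_commute)
  then have "- (2 * ((g t - w) \<bullet> T t)) = 0"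
  proof (rule DERIV_local_max[OF _ zero_less_one], intro allI impI)
    fix s
    have "(cmod (w - g t))\<^sup>2 \<le> (cmod (w - g s))\<^sup>2" using near[OF g_in[of s]] by (intro power_mono) auto
    then show "- ((g s - w) \<bullet> (g s - w)) \<le> - ((g t - w) \<bullet> (g t - w))"
      by (simp add: norm_minus_commute flip: power2_norm_eq_inner)
  qed
  then have "Re v = 0" by (simp add: v_def inner_complex_def algebra_simps)
  define y where "y = Im v"
  have v: "v = of_real y * \<i>" using \<open>Re v = 0\<close> by (simp add: complex_eq_iff y_def)
  have "v * T t = (w - g t) * (T t * cnj (T t))" by (simp only: v_def ac_simps)
  then have eq: "w - g t = of_real y * (\<i> * T t)" by (simp add: TT v mult.assoc)
  show thesis
  proof (rule that)
    show "w = g t + of_real y * (\<i> * T t)" using eq by (simp add: diff_eq_eq add.commute)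
    show "\<bar>y\<bar> = cmod (w - g t)" by (simp add: eq norm_mult T_unit)
  qed
qed

end

definition two_sided_ball_condition :: "real \<Rightarrow> complex set \<Rightarrow> bool" where
  "two_sided_ball_condition \<rho> \<Omega> \<longleftrightarrow> \<rho> > 0 \<and>
    (\<forall>p\<in>frontier \<Omega>. \<exists>n. cmod n = 1 \<and> ball (p + of_real \<rho> * n) \<rho> \<subseteq> \<Omega> \<and> ball (p - of_real \<rho> * n) \<rho> \<inter> \<Omega> = {})"

lemma connected_inside_or_disjoint:
  assumes "connected S" "S \<inter> frontier \<Omega> = {}" 
  shows "S \<subseteq> \<Omega> \<or> S \<inter> \<Omega> = {}"
  using connected_Int_frontier[OF assms(1), of \<Omega>] assms(2) by blast

text \<open>The centers on one side form a connected set disjoint from the curve, hence all balls on that side lie in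
\<open>\<Omega>\<close> or none meets it. The two sides must differ: every point near the curve lies on a normal and
therefore in one of the balls, while both components of the complement approach the curve.\<close>

lemma (in closed_unit_speed_curve) two_sided_ball_condition:
  assumes \<Omega>: "\<Omega> = inside \<Gamma>" "frontier \<Omega> = \<Gamma>" "frontier (outside \<Gamma>) = \<Gamma>" "open \<Omega>" "open (outside \<Gamma>)"
  obtains \<rho> where "two_sided_ball_condition \<rho> \<Omega>"
proof -
  obtain \<rho> where \<rho>: "\<rho> > 0" 
    "\<And>t x \<sigma>. 0 \<le> t \<Longrightarrow> t < l \<Longrightarrow> x \<in> \<Gamma> \<Longrightarrow> \<bar>\<sigma>\<bar> = \<rho> \<Longrightarrow> \<rho> \<le> cmod (x - center \<sigma> t)"
    using obtain_ball_radius by blast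
  have ballF: "ball (center \<sigma> t) \<rho> \<inter> frontier \<Omega> = {}" if "0 \<le> t" "t < l" "\<bar>\<sigma>\<bar> = \<rho>" for \<sigma> t
    using \<rho>(2)[OF that(1,2) _ that(3)] by (force simp: \<Omega>(2) dist_norm norm_minus_commute)
  have dich: "(\<forall>t\<in>{0..<l}. ball (center \<sigma> t) \<rho> \<subseteq> \<Omega>) \<or> (\<forall>t\<in>{0..<l}. ball (center \<sigma> t) \<rho> \<inter> \<Omega> = {})"
    if \<sigma>: "\<bar>\<sigma>\<bar> = \<rho>" for \<sigma>
  proof -
    have "L-lipschitz_on {0..<l} T" using T_lip L_pos by (auto intro!: lipschitz_onI simp: dist_norm)
    then have "continuous_on {0..<l} T" by (rule lipschitz_on_continuous_on)
    moreover have "continuous_on {0..<l} g"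
      using g_deriv has_vector_derivative_continuous by (blast intro: continuous_at_imp_continuous_on)
    ultimately have "continuous_on {0..<l} (center \<sigma>)"
      unfolding center_def[abs_def] by (intro continuous_intros)
    then have "connected (center \<sigma> ` {0..<l})" by (rule connected_continuous_image) simp
    moreover have "center \<sigma> t \<notin> frontier \<Omega>" if "t \<in> {0..<l}" for t
    proof -
      have "center \<sigma> t \<in> ball (center \<sigma> t) \<rho>" using \<rho>(1) by simp
      moreover have "ball (center \<sigma> t) \<rho> \<inter> frontier \<Omega> = {}" using ballF[of t \<sigma>] that \<sigma> by simp
      ultimately show ?thesis by blast
    qed
    ultimately have "center \<sigma> ` {0..<l} \<subseteq> \<Omega> \<or> center \<sigma> ` {0..<l} \<inter> \<Omega> = {}"
      by (intro connected_inside_or_disjoint) auto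
    moreover have part: "ball (center \<sigma> t) \<rho> \<subseteq> \<Omega> \<or> ball (center \<sigma> t) \<rho> \<inter> \<Omega> = {}" if "t \<in> {0..<l}" for t
      using ballF[of t \<sigma>] that \<sigma> by (intro connected_inside_or_disjoint) auto
    moreover have in_ball: "center \<sigma> t \<in> ball (center \<sigma> t) \<rho>" for t using \<rho>(1) by simp
    ultimately show ?thesis
    proof (elim disjE)
      assume c: "center \<sigma> ` {0..<l} \<subseteq> \<Omega>"
      have "ball (center \<sigma> t) \<rho> \<subseteq> \<Omega>" if t: "t \<in> {0..<l}" for t
        using part[OF t] in_ball[of t] imageI[OF t, of "center \<sigma>"] c by blast
      then show ?thesis by blast
    next
      assume c: "center \<sigma> ` {0..<l} \<inter> \<Omega> = {}"
      have "ball (center \<sigma> t) \<rho> \<inter> \<Omega> = {}" if t: "t \<in> {0..<l}" for t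
        using part[OF t] in_ball[of t] imageI[OF t, of "center \<sigma>"] c by blast
      then show ?thesis by blast
    qed
  qed
  have cover: "\<exists>t\<in>{0..<l}. w \<in> ball (center \<rho> t) \<rho> \<or> w \<in> ball (center (- \<rho>) t) \<rho>"
    if w: "w \<notin> \<Gamma>" "p \<in> \<Gamma>" "dist w p < \<rho>" for w p
  proof -
    have "closed \<Gamma>" using \<Omega>(2) frontier_closed by metis
    moreover have "\<Gamma> \<noteq> {}" using w by auto
    ultimately obtain q where q: "q \<in> \<Gamma>" "\<And>x. x \<in> \<Gamma> \<Longrightarrow> dist w q \<le> dist w x"
      using distance_attains_inf by blast
    obtain t where t: "0 \<le> t" "t < l" "q = g t" using obtain_parameter[OF q(1)] .
    have "cmod (w - g t) \<le> cmod (w - x)" if "x \<in> \<Gamma>" for x using q(2)[OF that] t by (simp add: dist_norm)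
    then obtain y where y: "w = g t + of_real y * (\<i> * T t)" "\<bar>y\<bar> = cmod (w - g t)"
      using nearest_point_normal by blast
    have "y \<noteq> 0" using w q t y by auto
    moreover have "\<bar>y\<bar> < \<rho>" using y(2) q(2)[OF w(2)] w(3) t by (simp add: dist_norm)
    moreover have "dist (center \<sigma> t) w = \<bar>\<sigma> - y\<bar>" for \<sigma>
    proof -
      have "center \<sigma> t - w = of_real (\<sigma> - y) * (\<i> * T t)"
        unfolding y(1) center_def by (simp add: algebra_simps)
      then have "dist (center \<sigma> t) w = cmod (of_real (\<sigma> - y)) * cmod (\<i> * T t)"
        unfolding dist_norm by (simp only: norm_mult)
      then show ?thesis by (simp only: norm_of_real norm_mult T_unit norm_ii mult_1_right)
    qed
    ultimately have "w \<in> ball (center \<rho> t) \<rho> \<or> w \<in> ball (center (- \<rho>) t) \<rho>" by auto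
    then show ?thesis using t by auto
  qed
  have approach: "\<exists>w p. w \<in> U \<and> w \<notin> \<Gamma> \<and> p \<in> \<Gamma> \<and> dist w p < \<rho>" if U: "open U" "frontier U = \<Gamma>" for U
  proof -
    obtain p where p: "p \<in> \<Gamma>" using g_in by blast
    then have "p \<in> closure U" using U by (auto simp: frontier_def)
    then obtain w where w: "w \<in> U" "dist w p < \<rho>" using \<rho>(1) by (auto simp: closure_approachable)
    moreover have "w \<notin> \<Gamma>" using U w by (auto simp: frontier_def interior_open)
    ultimately show ?thesis using p by blast
  qed
  have opp: "(\<forall>t\<in>{0..<l}. ball (center \<sigma> t) \<rho> \<subseteq> \<Omega>) \<and> (\<forall>t\<in>{0..<l}. ball (center (- \<sigma>) t) \<rho> \<inter> \<Omega> = {})" 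
    if "\<sigma> = \<rho> \<or> \<sigma> = - \<rho>" "\<forall>t\<in>{0..<l}. ball (center \<sigma> t) \<rho> \<subseteq> \<Omega>" for \<sigma>
  proof (rule conjI[OF that(2)], rule ccontr)
    assume "\<not> (\<forall>t\<in>{0..<l}. ball (center (- \<sigma>) t) \<rho> \<inter> \<Omega> = {})"
    moreover have "\<bar>- \<sigma>\<bar> = \<rho>" using that(1) \<rho>(1) by auto
    ultimately have "\<forall>t\<in>{0..<l}. ball (center (- \<sigma>) t) \<rho> \<subseteq> \<Omega>" using dich[of "- \<sigma>"] by blast
    with that have "(\<forall>t\<in>{0..<l}. ball (center \<rho> t) \<rho> \<subseteq> \<Omega>) \<and> (\<forall>t\<in>{0..<l}. ball (center (- \<rho>) t) \<rho> \<subseteq> \<Omega>)"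
      by (elim disjE) simp_all
    moreover obtain w p where "w \<in> outside \<Gamma>" "w \<notin> \<Gamma>" "p \<in> \<Gamma>" "dist w p < \<rho>"
      using approach[OF \<Omega>(5,3)] by blast
    ultimately have "w \<in> \<Omega>" using cover[of w p] by blast
    then show False using \<open>w \<in> outside \<Gamma>\<close> \<Omega>(1) inside_Int_outside by blast
  qed
  have "\<exists>\<sigma>. (\<sigma> = \<rho> \<or> \<sigma> = - \<rho>) \<and> (\<forall>t\<in>{0..<l}. ball (center \<sigma> t) \<rho> \<subseteq> \<Omega>)"
  proof (rule ccontr)
    assume "\<not> ?thesis"
    then have "\<not> (\<forall>t\<in>{0..<l}. ball (center \<rho> t) \<rho> \<subseteq> \<Omega>)" "\<not> (\<forall>t\<in>{0..<l}. ball (center (- \<rho>) t) \<rho> \<subseteq> \<Omega>)"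
      by blast+
    moreover have "\<bar>\<rho>\<bar> = \<rho>" "\<bar>- \<rho>\<bar> = \<rho>" using \<rho>(1) by auto
    ultimately have "\<forall>t\<in>{0..<l}. ball (center \<rho> t) \<rho> \<inter> \<Omega> = {}" "\<forall>t\<in>{0..<l}. ball (center (- \<rho>) t) \<rho> \<inter> \<Omega> = {}"
      using dich by blast+
    moreover obtain w p where "w \<in> \<Omega>" "w \<notin> \<Gamma>" "p \<in> \<Gamma>" "dist w p < \<rho>"
      using approach[OF \<Omega>(4,2)] by blast
    ultimately show False using cover[of w p] by blast
  qed
  then obtain \<sigma> where \<sigma>: "\<sigma> = \<rho> \<or> \<sigma> = - \<rho>" "\<forall>t\<in>{0..<l}. ball (center \<sigma> t) \<rho> \<subseteq> \<Omega>"
    "\<forall>t\<in>{0..<l}. ball (center (- \<sigma>) t) \<rho> \<inter> \<Omega> = {}" using opp by blast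
  show thesis
  proof (rule that, unfold two_sided_ball_condition_def, intro conjI ballI)
    show "\<rho> > 0" by (rule \<rho>(1))
  next
    fix p assume "p \<in> frontier \<Omega>"
    then obtain t where t: "t \<in> {0..<l}" "p = g t" using \<Omega>(2) obtain_parameter by (metis atLeastLessThan_iff)
    define n where "n = of_real (\<sigma> / \<rho>) * (\<i> * T t)"
    have \<sigma>\<rho>: "\<bar>\<sigma> / \<rho>\<bar> = 1" "\<rho> * (\<sigma> / \<rho>) = \<sigma>" using \<sigma>(1) \<rho>(1) by auto
    have rn: "of_real \<rho> * n = of_real \<sigma> * (\<i> * T t)"
      unfolding n_def mult.assoc[symmetric] of_real_mult[symmetric] \<sigma>\<rho>(2) ..
    have "cmod n = 1" unfolding n_def by (simp only: norm_mult norm_of_real \<sigma>\<rho> T_unit norm_ii mult_1)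
    moreover have "p + of_real \<rho> * n = center \<sigma> t" "p - of_real \<rho> * n = center (- \<sigma>) t"
      unfolding rn center_def t(2) by simp_all
    ultimately show "\<exists>n. cmod n = 1 \<and> ball (p + of_real \<rho> * n) \<rho> \<subseteq> \<Omega> \<and> ball (p - of_real \<rho> * n) \<rho> \<inter> \<Omega> = {}"
      using \<sigma>(2,3) t(1) by (intro exI[of _ n]) auto
  qed
qed

lemma Jordan_domain_C11_two_sided_ball_condition:
  assumes "Jordan_domain \<Omega>" "Jordan_curve_of_class 1 1 (frontier \<Omega>)"
  obtains \<rho> where "two_sided_ball_condition \<rho> \<Omega>" and "open \<Omega>" "bounded \<Omega>"
proof -
  obtain \<gamma> where \<gamma>: "simple_path \<gamma>" "pathfinish \<gamma> = pathstart \<gamma>" "\<Omega> = inside (path_image \<gamma>)"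
    using assms(1) unfolding Jordan_domain_def Jordan_curve_def by blast
  note J = Jordan_inside_outside[OF \<gamma>(1,2)]
  have fr: "frontier \<Omega> = path_image \<gamma>" using J \<gamma>(3) by simp
  obtain l g T L where "closed_unit_speed_curve (frontier \<Omega>) l g T L"
    using Jordan_curve_of_class_1_1_imp_closed_unit_speed_curve[OF assms(2)] .
  then interpret closed_unit_speed_curve "frontier \<Omega>" l g T L .
  obtain \<rho> where "two_sided_ball_condition \<rho> \<Omega>"
    by (rule two_sided_ball_condition[of \<Omega>]) (use J \<gamma>(3) fr in simp_all)
  then show thesis using that J \<gamma>(3) by simp
qed

section \<open>Short polygons in the domain and the co-Lipschitz estimate\<close>

lemma dist_ge_of_disjoint_balls:
  fixes x y :: "'a::real_normed_vector"
  assumes "ball x r \<inter> ball y s = {}" "r > 0" "s > 0"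
  shows "r + s \<le> dist x y"
proof (rule ccontr)
  assume lt: "\<not> r + s \<le> dist x y"
  define t where "t = r / (r + s)"
  have t: "0 \<le> t" "0 \<le> 1 - t" "t * (r + s) = r" "(1 - t) * (r + s) = s" 
    "t > 0" "1 - t > 0" using assms by (auto simp: t_def field_simps)
  define z where "z = x + t *\<^sub>R (y - x)"
  have "dist x z = t * dist x y" using t by (simp add: z_def dist_norm norm_minus_commute)
  also have "\<dots> < t * (r + s)" using t lt by (intro mult_strict_left_mono) auto
  finally have "z \<in> ball x r" using t by simp
  moreover have "y - z = (1 - t) *\<^sub>R (y - x)" by (simp add: z_def algebra_simps)
  then have "dist y z = (1 - t) * dist x y" using t by (simp add: dist_norm norm_minus_commute)
  have "(1 - t) * dist x y < (1 - t) * (r + s)" using t lt by (intro mult_strict_left_mono) auto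
  then have "z \<in> ball y s" using t \<open>dist y z = _\<close> by simp
  ultimately show False using assms(1) by blast
qed

lemma obtain_nearest_frontier_point:
  fixes w :: complex
  assumes "bounded \<Omega>" "w \<in> \<Omega>" 
  obtains p where "p \<in> frontier \<Omega>" "ball w (dist w p) \<subseteq> \<Omega>" "\<And>x. x \<in> frontier \<Omega> \<Longrightarrow> dist w p \<le> dist w x"
proof -
  have "frontier \<Omega> \<noteq> {}"
    using assms frontier_not_empty not_bounded_UNIV by blast
  then obtain p where p: "p \<in> frontier \<Omega>" "\<And>x. x \<in> frontier \<Omega> \<Longrightarrow> dist w p \<le> dist w x"
    using distance_attains_inf[OF frontier_closed] by blast
  have "ball w (dist w p) \<subseteq> \<Omega>"
  proof (cases "w = p")
    case False
    have "ball w (dist w p) \<inter> frontier \<Omega> = {}" using p(2) by (force simp: not_less)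
    moreover have "w \<in> ball w (dist w p) \<inter> \<Omega>" using False assms by simp
    ultimately show ?thesis using connected_inside_or_disjoint[OF connected_ball, of w "dist w p" \<Omega>] by blast
  qed simp
  with p that show thesis by blast
qed

text \<open>At each of the two points, the interior ball is disjoint from the exterior ball at the other point. This
bounds \<open>\<bar>P + N\<bar>\<close> and \<open>\<bar>P - N\<bar>\<close> below by \<open>2 \<rho>\<close>, where \<open>P = p1 - p2\<close> and \<open>N = \<rho> (n1 + n2)\<close>, and the
parallelogram law, applied twice, gives the claim.\<close>

lemma normals_Lipschitz:
  fixes p1 p2 n1 n2 :: complex
  assumes n: "cmod n1 = 1" "cmod n2 = 1" and \<rho>: "\<rho> > 0"
    and disj: "ball (p1 + of_real \<rho> * n1) \<rho> \<inter> ball (p2 - of_real \<rho> * n2) \<rho> = {}"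
      "ball (p2 + of_real \<rho> * n2) \<rho> \<inter> ball (p1 - of_real \<rho> * n1) \<rho> = {}"
  shows "\<rho> * cmod (n1 - n2) \<le> cmod (p1 - p2)"
proof -
  define P N where "P = p1 - p2" and "N = of_real \<rho> * (n1 + n2)"
  have par: "(cmod (x + y))\<^sup>2 + (cmod (x - y))\<^sup>2 = 2 * (cmod x)\<^sup>2 + 2 * (cmod y)\<^sup>2" for x y
    unfolding cmod_power2 by (simp add: power2_eq_square algebra_simps)
  have "2 * \<rho> \<le> cmod (P + N)" "2 * \<rho> \<le> cmod (P - N)"
    using dist_ge_of_disjoint_balls[OF disj(1) \<rho> \<rho>] dist_ge_of_disjoint_balls[OF disj(2) \<rho> \<rho>]
    by (simp_all add: P_def N_def dist_norm algebra_simps norm_minus_commute)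
  then have "(2 * \<rho>)\<^sup>2 + (2 * \<rho>)\<^sup>2 \<le> (cmod (P + N))\<^sup>2 + (cmod (P - N))\<^sup>2"
    using \<rho> by (intro add_mono power_mono) auto
  then have "4 * \<rho>\<^sup>2 \<le> (cmod P)\<^sup>2 + (cmod N)\<^sup>2" unfolding par by (simp add: power_mult_distrib)
  moreover have "(cmod N)\<^sup>2 = \<rho>\<^sup>2 * (cmod (n1 + n2))\<^sup>2"
    using \<rho> by (simp add: N_def norm_mult power_mult_distrib)
  moreover have "(cmod (n1 + n2))\<^sup>2 = 4 - (cmod (n1 - n2))\<^sup>2" using par[of n1 n2] n by simp
  ultimately have "\<rho>\<^sup>2 * (cmod (n1 - n2))\<^sup>2 \<le> (cmod P)\<^sup>2" by (simp add: algebra_simps)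
  then have "(\<rho> * cmod (n1 - n2))\<^sup>2 \<le> (cmod P)\<^sup>2" by (simp add: power_mult_distrib)
  then show ?thesis unfolding P_def by (rule power2_le_imp_le) simp
qed

text \<open>The ball about \<open>w\<close> and the exterior ball at \<open>p\<close> are disjoint and both touch \<open>p\<close>, so the triangle
inequality for their centers and \<open>p\<close> is an equality.\<close>

lemma nearest_point_on_normal:
  fixes w p n :: complex
  assumes n: "cmod n = 1" and \<rho>: "\<rho> > 0" and w: "ball w (dist w p) \<subseteq> \<Omega>" "w \<noteq> p" 
    and ext: "ball (p - of_real \<rho> * n) \<rho> \<inter> \<Omega> = {}"
  shows "w = p + of_real (dist w p) * n"
proof -
  have "ball w (dist w p) \<inter> ball (p - of_real \<rho> * n) \<rho> = {}" using w(1) ext by blast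
  then have "dist w p + \<rho> \<le> dist w (p - of_real \<rho> * n)"
    by (rule dist_ge_of_disjoint_balls) (use w \<rho> in auto)
  then have "cmod (w - p) + cmod (of_real \<rho> * n) \<le> cmod ((w - p) + of_real \<rho> * n)"
    using n \<rho> by (simp add: dist_norm norm_mult algebra_simps)
  then have "cmod ((w - p) + of_real \<rho> * n) = cmod (w - p) + cmod (of_real \<rho> * n)"
    using norm_triangle_ineq[of "w - p" "of_real \<rho> * n"] by linarith
  then have "cmod (w - p) *\<^sub>R (of_real \<rho> * n) = cmod (of_real \<rho> * n) *\<^sub>R (w - p)"
    by (simp only: norm_triangle_eq)
  then have "of_real \<rho> * (of_real (cmod (w - p)) * n) = of_real \<rho> * (w - p)"
    using n \<rho> by (simp add: scaleR_conv_of_real norm_mult algebra_simps)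
  then have "of_real (cmod (w - p)) * n = w - p" using \<rho> by simp
  then show ?thesis by (simp add: dist_norm)
qed

text \<open>Let \<open>s = \<bar>w1 - w2\<bar>\<close>. If the segment is not obviously inside \<open>\<Omega>\<close>, both points are within \<open>2 s\<close> of the
boundary, and their nearest boundary points are at distance at most \<open>4 s\<close>. Moving along the normals to
depth \<open>\<tau> \<le> \<rho>\<close> at most doubles this distance, to \<open>8 s\<close>, by \<open>normals_Lipschitz\<close>; thus \<open>\<tau> = 9 s\<close> keeps the
connecting segment in the ball of radius \<open>\<tau>\<close> about its end point, and \<open>26 = 9 + 8 + 9\<close>.\<close>

lemma two_sided_ball_condition_short_polygon:
  assumes tsb: "two_sided_ball_condition \<rho> \<Omega>" and "open \<Omega>" and bd: "bounded \<Omega>"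
    and w: "w1 \<in> \<Omega>" "w2 \<in> \<Omega>" and s: "9 * cmod (w1 - w2) \<le> \<rho>"
  obtains v1 v2 where "closed_segment w1 v1 \<subseteq> \<Omega>" "closed_segment v1 v2 \<subseteq> \<Omega>" "closed_segment v2 w2 \<subseteq> \<Omega>"
    "cmod (w1 - v1) + cmod (v1 - v2) + cmod (v2 - w2) \<le> 26 * cmod (w1 - w2)"
proof -
  define s where "s = cmod (w1 - w2)"
  note \<rho> = tsb[unfolded two_sided_ball_condition_def, THEN conjunct1]
    and balls = tsb[unfolded two_sided_ball_condition_def, THEN conjunct2, rule_format]
  obtain p1 where p1: "p1 \<in> frontier \<Omega>" "ball w1 (dist w1 p1) \<subseteq> \<Omega>" "\<And>x. x \<in> frontier \<Omega> \<Longrightarrow> dist w1 p1 \<le> dist w1 x"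
    using obtain_nearest_frontier_point[OF bd w(1)] by blast
  obtain p2 where p2: "p2 \<in> frontier \<Omega>" "ball w2 (dist w2 p2) \<subseteq> \<Omega>" "\<And>x. x \<in> frontier \<Omega> \<Longrightarrow> dist w2 p2 \<le> dist w2 x"
    using obtain_nearest_frontier_point[OF bd w(2)] by blast
  have ne: "w1 \<noteq> p1" "w2 \<noteq> p2" 
    using p1(1) p2(1) w \<open>open \<Omega>\<close> by (auto simp: frontier_def interior_open)
  show thesis
  proof (cases "s < dist w1 p1")
    case True
    then have "closed_segment w1 w2 \<subseteq> ball w1 (dist w1 p1)"
      using ne(1) by (intro closed_segment_subset) (auto simp: s_def dist_norm)
    then have "closed_segment w1 w2 \<subseteq> \<Omega>" using p1(2) by blast
    then show thesis using w by (intro that[of w1 w2]) (auto simp: s_def)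
  next
    case False
    define d1 d2 where "d1 = dist w1 p1" and "d2 = dist w2 p2"
    have d: "0 < d1" "0 < d2" "d1 \<le> s" using ne False by (simp_all add: d1_def d2_def)
    have "d2 \<le> dist w2 p1" unfolding d2_def by (rule p2(3)[OF p1(1)])
    also have "\<dots> \<le> s + d1" using dist_triangle[of w2 p1 w1] by (simp add: s_def d1_def dist_norm norm_minus_commute)
    finally have d2: "d2 \<le> 2 * s" using d by simp
    obtain n1 where n1: "cmod n1 = 1" "ball (p1 + of_real \<rho> * n1) \<rho> \<subseteq> \<Omega>" "ball (p1 - of_real \<rho> * n1) \<rho> \<inter> \<Omega> = {}"
      using balls[OF p1(1)] by blast
    obtain n2 where n2: "cmod n2 = 1" "ball (p2 + of_real \<rho> * n2) \<rho> \<subseteq> \<Omega>" "ball (p2 - of_real \<rho> * n2) \<rho> \<inter> \<Omega> = {}"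
      using balls[OF p2(1)] by blast
    have w1: "w1 = p1 + of_real d1 * n1" and w2: "w2 = p2 + of_real d2 * n2"
      unfolding d1_def d2_def
      using nearest_point_on_normal[OF n1(1) \<rho> p1(2) ne(1) n1(3)] nearest_point_on_normal[OF n2(1) \<rho> p2(2) ne(2) n2(3)] by blast+
    define \<tau> where "\<tau> = 9 * s"
    have \<tau>: "0 < \<tau>" "\<tau> \<le> \<rho>" "d1 \<le> \<tau>" "d2 \<le> \<tau>" using d d2 s by (auto simp: \<tau>_def s_def)
    have on_normal: "p + of_real t * n \<in> ball (p + of_real \<rho> * n) \<rho>" if "0 < t" "t \<le> \<rho>" "cmod n = 1" for p n t
    proof -
      have "dist (p + of_real \<rho> * n) (p + of_real t * n) = cmod (of_real (\<rho> - t) * n)"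
        unfolding dist_norm by (simp add: algebra_simps)
      also have "\<dots> = \<rho> - t" using that by (simp only: norm_mult norm_of_real) simp
      finally show ?thesis using that by simp
    qed
    define v1 v2 where "v1 = p1 + of_real \<tau> * n1" and "v2 = p2 + of_real \<tau> * n2"
    have seg1: "closed_segment w1 v1 \<subseteq> \<Omega>"
    proof -
      have "closed_segment w1 v1 \<subseteq> ball (p1 + of_real \<rho> * n1) \<rho>"
        unfolding w1 v1_def using \<tau> d n1(1) by (intro closed_segment_subset on_normal) auto
      then show ?thesis using n1(2) by blast
    qed
    have seg2: "closed_segment v2 w2 \<subseteq> \<Omega>"
    proof -
      have "closed_segment v2 w2 \<subseteq> ball (p2 + of_real \<rho> * n2) \<rho>"
        unfolding w2 v2_def using \<tau> d n2(1) by (intro closed_segment_subset on_normal) auto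
      then show ?thesis using n2(2) by blast
    qed
    have len: "cmod (p + of_real t * n - (p + of_real \<tau> * n)) \<le> 9 * s" if "0 < t" "t \<le> \<tau>" "cmod n = 1" for p n t
    proof -
      have "p + of_real t * n - (p + of_real \<tau> * n) = of_real (t - \<tau>) * n" by (simp add: algebra_simps)
      also have "cmod \<dots> = \<tau> - t" using that by (simp only: norm_mult norm_of_real) simp
      finally show ?thesis using that by (simp add: \<tau>_def)
    qed
    have "cmod (p1 - p2) = cmod ((p1 - w1) + (w1 - w2) + (w2 - p2))" by simp
    also have "\<dots> \<le> cmod (p1 - w1) + cmod (w1 - w2) + cmod (w2 - p2)"
      by (meson norm_triangle_ineq norm_triangle_le add_right_mono order_trans)
    also have "\<dots> = d1 + s + d2" by (simp add: d1_def d2_def s_def dist_norm norm_minus_commute)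
    finally have p12: "cmod (p1 - p2) \<le> 4 * s" using d d2 by simp
    have "\<rho> * cmod (n1 - n2) \<le> cmod (p1 - p2)"
      by (rule normals_Lipschitz[OF n1(1) n2(1) \<rho>]) (use n1 n2 in blast)+
    moreover have "\<tau> * cmod (n1 - n2) \<le> \<rho> * cmod (n1 - n2)" using \<tau> by (intro mult_right_mono) auto
    moreover have "v1 - v2 = (p1 - p2) + of_real \<tau> * (n1 - n2)" by (simp add: v1_def v2_def algebra_simps)
    then have "cmod (v1 - v2) \<le> cmod (p1 - p2) + \<tau> * cmod (n1 - n2)"
      using norm_triangle_ineq[of "p1 - p2" "of_real \<tau> * (n1 - n2)"] \<tau>(1) by (simp add: norm_mult)
    ultimately have v12: "cmod (v1 - v2) \<le> 8 * s" using p12 by linarith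
    have "ball v1 \<tau> \<subseteq> ball (p1 + of_real \<rho> * n1) \<rho>"
    proof -
      have "dist v1 (p1 + of_real \<rho> * n1) = cmod (of_real (\<tau> - \<rho>) * n1)"
        unfolding dist_norm v1_def by (simp add: algebra_simps)
      also have "\<dots> = \<rho> - \<tau>" using \<tau> n1(1) by (simp only: norm_mult norm_of_real) simp
      finally show ?thesis by (simp add: ball_subset_ball_iff)
    qed
    moreover have "closed_segment v1 v2 \<subseteq> ball v1 \<tau>"
      using \<tau>(1) v12 by (intro closed_segment_subset) (auto simp: \<tau>_def dist_norm)
    ultimately have seg12: "closed_segment v1 v2 \<subseteq> \<Omega>" using n1(2) by blast
    have "cmod (w1 - v1) \<le> 9 * s" "cmod (w2 - v2) \<le> 9 * s"
      unfolding w1 w2 v1_def v2_def using len d \<tau> n1(1) n2(1) by blast+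
    then have "cmod (w1 - v1) + cmod (v1 - v2) + cmod (v2 - w2) \<le> 26 * s"
      using v12 by (simp add: norm_minus_commute)
    then show thesis using that[OF seg1 seg12 seg2] unfolding s_def by blast
  qed
qed

lemma (in harmonic_homeomorphism) \<psi>_Lipschitz:
  assumes m: "m > 0" "\<And>z. z \<in> D \<Longrightarrow> m \<le> cmod (deriv g z)" and D: "D \<subseteq> ball 0 1"
    and tsb: "two_sided_ball_condition \<rho> \<Omega>" and bd: "bounded \<Omega>"
    and w: "w1 \<in> \<Omega>" "w2 \<in> \<Omega>"
  shows "cmod (\<psi> w1 - \<psi> w2) \<le> max (26 * (K / m)) (18 / \<rho>) * cmod (w1 - w2)"
proof (cases "9 * cmod (w1 - w2) \<le> \<rho>")
  case True
  obtain v1 v2 where v: "closed_segment w1 v1 \<subseteq> \<Omega>" "closed_segment v1 v2 \<subseteq> \<Omega>" "closed_segment v2 w2 \<subseteq> \<Omega>"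
    "cmod (w1 - v1) + cmod (v1 - v2) + cmod (v2 - w2) \<le> 26 * cmod (w1 - w2)"
    using two_sided_ball_condition_short_polygon[OF tsb open_\<Omega> bd w True] .
  have "cmod (\<psi> w1 - \<psi> w2) = cmod ((\<psi> w1 - \<psi> v1) + (\<psi> v1 - \<psi> v2) + (\<psi> v2 - \<psi> w2))" by simp
  also have "\<dots> \<le> cmod (\<psi> w1 - \<psi> v1) + cmod (\<psi> v1 - \<psi> v2) + cmod (\<psi> v2 - \<psi> w2)"
    by (meson norm_triangle_ineq norm_triangle_le add_right_mono order_trans)
  also have "\<dots> \<le> K / m * cmod (w1 - v1) + K / m * cmod (v1 - v2) + K / m * cmod (v2 - w2)"
    by (intro add_mono \<psi>_Lipschitz_on_segment m v)
  also have "\<dots> = K / m * (cmod (w1 - v1) + cmod (v1 - v2) + cmod (v2 - w2))" by (simp add: algebra_simps)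
  also have "\<dots> \<le> K / m * (26 * cmod (w1 - w2))"
    using v(4) m(1) K_ge_1 by (intro mult_left_mono) auto
  also have "\<dots> = 26 * (K / m) * cmod (w1 - w2)" by simp
  also have "\<dots> \<le> max (26 * (K / m)) (18 / \<rho>) * cmod (w1 - w2)" by (intro mult_right_mono) auto
  finally show ?thesis .
next
  case False
  have \<rho>: "\<rho> > 0" using tsb by (simp add: two_sided_ball_condition_def)
  have "\<psi> w1 \<in> ball 0 1" "\<psi> w2 \<in> ball 0 1" using \<psi>_in w D by blast+
  then have "cmod (\<psi> w1) < 1" "cmod (\<psi> w2) < 1" by simp_all
  then have "cmod (\<psi> w1 - \<psi> w2) \<le> 2" using norm_triangle_ineq4[of "\<psi> w1" "\<psi> w2"] by linarith
  also have "\<dots> \<le> 18 / \<rho> * cmod (w1 - w2)" using False \<rho> by (simp add: field_simps)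
  also have "\<dots> \<le> max (26 * (K / m)) (18 / \<rho>) * cmod (w1 - w2)" by (intro mult_right_mono) auto
  finally show ?thesis .
qed

text \<open>The constant \<open>c\<close> depends on \<open>f\<close> only through \<open>K\<close>, the geometry of \<open>\<Omega>\<close> and a lower bound \<open>2 \<delta>\<close> of the distance
from \<open>f 0\<close> to the boundary. The radius \<open>r0\<close> is chosen such that \<open>f\<close> moves points of the disk of radius \<open>r0\<close> by at
most \<open>\<delta>\<close>, which provides the bound on the inner circle of the Hopf barrier.\<close>

lemma (in harmonic_homeomorphism) deriv_g_lower_bound:
  assumes disc: "D = ball 0 1" and tsb: "two_sided_ball_condition \<rho> \<Omega>"
    and M: "M > 0" "\<And>w. w \<in> \<Omega> \<Longrightarrow> cmod w \<le> M" 
    and \<delta>: "\<delta> > 0" "ball (f 0) (2 * \<delta>) \<subseteq> \<Omega>"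
    and r0: "r0 = min (1 / 2) (\<delta> / (8 * exp (2 * M)))"
    and l: "l = K\<^sup>2 / \<rho>\<^sup>2" and m: "m = 2 / r0\<^sup>2" 
    and \<eta>: "\<eta> = exp (- (l * \<rho>\<^sup>2)) - exp (- (l * (\<rho> + \<delta>)\<^sup>2))"
    and c: "c = min \<delta> (\<eta> * (exp (- m) * m) / (l * (2 * \<rho> + 2 * M)))"
    and z: "z \<in> D"
  shows "c / 4 \<le> cmod (deriv g z)"
proof -
  note \<rho> = tsb[unfolded two_sided_ball_condition_def, THEN conjunct1]
    and balls = tsb[unfolded two_sided_ball_condition_def, THEN conjunct2, rule_format]
  have z1: "cmod z < 1" using z disc by simp
  have r0': "0 < r0" "r0 \<le> 1/2" "8 * exp (2 * M) * r0 \<le> \<delta>"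
  proof -
    have "r0 \<le> \<delta> / (8 * exp (2 * M))" by (simp add: r0)
    then show "8 * exp (2 * M) * r0 \<le> \<delta>" by (simp add: field_simps)
  qed (use \<delta>(1) in \<open>auto simp: r0\<close>)
  have near0: "cmod (f w - f 0) \<le> \<delta>" if "cmod w \<le> r0" for w
  proof -
    have w: "w \<in> D" "0 \<in> D" using that r0' disc by auto
    have "cmod (f w - f 0) \<le> 8 * exp (2 * M) * cmod w"
      unfolding f_eq[OF w(1)] f_eq[OF w(2)]
    proof (rule bounded_harmonic_Lipschitz_at_0)
      show "cmod (g x + cnj (h x)) \<le> M" if "cmod x < 1" for x
        using M(2)[OF f_in[of x]] f_eq[of x] that disc by simp
    qed (use holo_g holo_h disc that r0' in auto)
    also have "\<dots> \<le> 8 * exp (2 * M) * r0" using that by (intro mult_left_mono) auto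
    finally show ?thesis using r0' by simp
  qed
  have bd: "bounded \<Omega>" using M(2) bounded_iff by blast
  have in_M: "cmod p \<le> M" if "p \<in> frontier \<Omega>" for p
  proof -
    have "\<Omega> \<subseteq> cball 0 M" using M(2) by auto
    then have "closure \<Omega> \<subseteq> cball 0 M" by (rule closure_minimal) simp
    then show ?thesis using that by (auto simp: frontier_def)
  qed
  have "ball (f z) (c * (1 - cmod z)) \<subseteq> \<Omega>"
  proof (cases "cmod z \<le> r0")
    case True
    have "c * (1 - cmod z) \<le> \<delta> * 1" using z1 \<delta>(1) 
      by (intro mult_mono) (auto simp: c)
    then have "ball (f z) (c * (1 - cmod z)) \<subseteq> ball (f 0) (2 * \<delta>)"
      using near0[OF True] by (auto simp: ball_subset_ball_iff dist_norm)
    then show ?thesis using \<delta>(2) by blast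
  next
    case False
    obtain p where p: "p \<in> frontier \<Omega>" "ball (f z) (dist (f z) p) \<subseteq> \<Omega>"
      by (rule obtain_nearest_frontier_point[OF bd f_in[OF z]])
    obtain n where n: "cmod n = 1" "ball (p - of_real \<rho> * n) \<rho> \<inter> \<Omega> = {}" using balls[OF p(1)] by blast
    define q where "q = p - of_real \<rho> * n"
    have "ball (f 0) (2 * \<delta>) \<inter> ball q \<rho> = {}" using \<delta>(2) n(2) unfolding q_def by blast
    then have far0: "2 * \<delta> + \<rho> \<le> dist (f 0) q"
      using \<delta>(1) \<rho> by (intro dist_ge_of_disjoint_balls) simp_all
    have "\<eta> * (exp (- m) * m) / (l * (2 * \<rho> + 2 * M)) * (1 - cmod z) \<le> dist (f z) p"
    proof (rule dist_exterior_ball_ge[OF disc \<rho>])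
      show "ball q \<rho> \<inter> \<Omega> = {}" unfolding q_def by (rule n)
      show "\<rho> + \<delta> \<le> cmod (f w - q)" if "cmod w = r0" for w
        using far0 near0[of w] that norm_triangle_ineq[of "f 0 - f w" "f w - q"]
        by (simp add: dist_norm norm_minus_commute)
      have "cmod (f z - q) = cmod ((f z - p) + of_real \<rho> * n)" by (simp add: q_def algebra_simps)
      also have "\<dots> \<le> cmod (f z - p) + cmod (of_real \<rho> * n)" by (rule norm_triangle_ineq)
      also have "\<dots> = \<rho> + dist (f z) p" using n(1) \<rho> by (simp add: dist_norm norm_mult)
      finally show "cmod (f z - q) \<le> \<rho> + dist (f z) p" .
      show "dist (f z) p \<le> 2 * M"
        using norm_triangle_ineq4[of "f z" p] M(2)[OF f_in[OF z]] in_M[OF p(1)] by (simp add: dist_norm)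
    qed (use r0' False z \<delta> l m \<eta> in auto)
    moreover have "c * (1 - cmod z) \<le> \<eta> * (exp (- m) * m) / (l * (2 * \<rho> + 2 * M)) * (1 - cmod z)"
      using z1 by (intro mult_right_mono) (auto simp: c)
    ultimately have "ball (f z) (c * (1 - cmod z)) \<subseteq> ball (f z) (dist (f z) p)"
      by (intro subset_ball) linarith
    then show ?thesis using p(2) by blast
  qed
  from deriv_g_ge_dist[OF disc z this]
  have "c * (1 - cmod z) / 2 \<le> cmod (deriv g z) * (1 - (cmod z)\<^sup>2)" .
  also have "\<dots> = cmod (deriv g z) * (1 + cmod z) * (1 - cmod z)"
    by (simp add: power2_eq_square algebra_simps)
  also have "\<dots> \<le> cmod (deriv g z) * 2 * (1 - cmod z)"
    using z1 by (intro mult_right_mono mult_left_mono) auto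
  also have "\<dots> = cmod (deriv g z) * (2 * (1 - cmod z))" by (simp only: mult.assoc)
  also have "c * (1 - cmod z) / 2 = (c / 4) * (2 * (1 - cmod z))" by simp
  finally have "(c / 4) * (2 * (1 - cmod z)) \<le> cmod (deriv g z) * (2 * (1 - cmod z))" .
  moreover have "0 < 2 * (1 - cmod z)" using z1 by simp
  ultimately show ?thesis by (simp only: mult_le_cancel_right_pos)
qed

theorem theorem1p4:
  fixes K :: real and \<Omega> :: "complex set" and a :: complex
  assumes "K \<ge> 1"
    and "Jordan_domain \<Omega>"
    and "Jordan_curve_of_class 1 1 (frontier \<Omega>)"
    and "a \<in> \<Omega>"
  shows "\<exists>c\<ge>1::real. \<forall>f :: complex \<Rightarrow> complex.
           harmonic_on (ball 0 1) f \<and> quasiconformal K (ball 0 1) \<Omega> f \<and> f 0 = a \<longrightarrow>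
           (\<forall>z\<^sub>1\<in>ball 0 1. \<forall>z\<^sub>2\<in>ball 0 1. 1 / c * cmod (z\<^sub>1 - z\<^sub>2) \<le> cmod (f z\<^sub>1 - f z\<^sub>2))"
proof -
  obtain \<rho> where tsb: "two_sided_ball_condition \<rho> \<Omega>" and \<Omega>: "open \<Omega>" "bounded \<Omega>"
    using Jordan_domain_C11_two_sided_ball_condition[OF assms(2,3)] .
  have \<rho>: "\<rho> > 0" using tsb by (simp add: two_sided_ball_condition_def)
  obtain M where M: "M > 0" "\<And>w. w \<in> \<Omega> \<Longrightarrow> cmod w \<le> M"
    using \<Omega>(2) unfolding bounded_pos by blast
  obtain e where e: "e > 0" "ball a e \<subseteq> \<Omega>" using \<Omega>(1) assms(4) open_contains_ball_eq by blast
  define \<delta> where "\<delta> = e / 2"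
  have \<delta>: "\<delta> > 0" "ball a (2 * \<delta>) \<subseteq> \<Omega>" using e by (simp_all add: \<delta>_def)
  define r0 where "r0 = min (1 / 2) (\<delta> / (8 * exp (2 * M)))"
  define l m where "l = K\<^sup>2 / \<rho>\<^sup>2" and "m = 2 / r0\<^sup>2"
  define \<eta> where "\<eta> = exp (- (l * \<rho>\<^sup>2)) - exp (- (l * (\<rho> + \<delta>)\<^sup>2))"
  define b where "b = min \<delta> (\<eta> * (exp (- m) * m) / (l * (2 * \<rho> + 2 * M)))"
  have "r0 > 0" using \<delta>(1) by (simp add: r0_def)
  then have lm: "l > 0" "m > 0" using assms(1) \<rho> by (auto simp: l_def m_def)
  have "\<rho>\<^sup>2 < (\<rho> + \<delta>)\<^sup>2" using \<rho> \<delta>(1) by (intro power_strict_mono) auto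
  then have "\<eta> > 0" using lm by (simp add: \<eta>_def)
  then have b: "b > 0" using \<delta>(1) lm \<rho> M(1) by (simp add: b_def)
  define c where "c = max 1 (max (26 * (K / (b / 4))) (18 / \<rho>))"
  show ?thesis
  proof (intro exI conjI allI impI ballI)
    show "1 \<le> c" by (simp add: c_def)
    fix f :: "complex \<Rightarrow> complex" and z1 z2 :: complex
    assume f: "harmonic_on (ball 0 1) f \<and> quasiconformal K (ball 0 1) \<Omega> f \<and> f 0 = a"
      and z: "z1 \<in> ball 0 1" "z2 \<in> ball 0 1"
    obtain g h where gh: "g holomorphic_on ball 0 1" "h holomorphic_on ball 0 1"
      "\<And>z. z \<in> ball 0 1 \<Longrightarrow> f z = g z + cnj (h z)"
      using harmonic_on_eq_holomorphic_plus_cnj[OF open_ball convex_ball] f by blast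
    obtain \<psi> where "homeomorphism (ball 0 1) \<Omega> f \<psi>"
      using f unfolding quasiconformal_def by blast
    then interpret harmonic_homeomorphism "ball 0 1" \<Omega> f \<psi> g h K
      using \<Omega> gh assms(1) quasiconformal_derivs_le[OF conjunct1[OF conjunct2[OF f]] gh]
      by unfold_locales auto
    have f0: "f 0 = a" using f by blast
    have "b / 4 \<le> cmod (deriv g z)" if "z \<in> ball 0 1" for z
      by (rule deriv_g_lower_bound[OF refl tsb M \<delta>(1) _ r0_def l_def m_def \<eta>_def b_def that])
        (use \<delta>(2) f0 in simp_all)
    then have "cmod (\<psi> (f z1) - \<psi> (f z2)) \<le> max (26 * (K / (b / 4))) (18 / \<rho>) * cmod (f z1 - f z2)"
      by (intro \<psi>_Lipschitz[OF _ _ _ tsb \<Omega>(2)] f_in z) (use b in auto)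
    also have "\<dots> \<le> c * cmod (f z1 - f z2)" by (intro mult_right_mono) (auto simp: c_def)
    finally have "cmod (z1 - z2) \<le> c * cmod (f z1 - f z2)" using z by (simp add: \<psi>_f)
    moreover have "c > 0" by (simp add: c_def)
    ultimately show "1 / c * cmod (z1 - z2) \<le> cmod (f z1 - f z2)" by (simp add: field_simps)
  qed
qed

end
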